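(* Let $n\ge 4$ be an even integer. There exists $\lambda_2>\sqrt{3}$ such that $Z_{\lambda_2}h_n(\tfrac16,\tfrac12)=0$ and none of the following six points belongs to $\mathscr{F}(h_n)$: $$\left(\tfrac{\lambda_2}{3},\tfrac1{\lambda_2}\right),\ \left(\tfrac{2\lambda_2}{3},\tfrac1{\lambda_2}\right),\ \left(\tfrac1{\lambda_2},\tfrac{\lambda_2}{3}\right),\ \left(\tfrac1{\lambda_2},\tfrac{2\lambda_2}{3}\right),\ \left(\tfrac{2}{\lambda_2},\tfrac{\lambda_2}{3}\right),\ \left(\tfrac{\lambda_2}{3},\tfrac{2}{\lambda_2}\right).$$
   Context: For $n\in\mathbb{Z}_{\ge 0}$ the Hermite function is $h_n(x) = (-1)^n c_n^{-1/2} e^{\pi x^2}\frac{d^n}{dx^n}e^{-2\pi x^2}$, $x\in\mathbb{R}$, with $c_n=(2\pi)^n 2^{n-1/2} n!$. For $\lambda>0$ the Zak transform is $Z_\lambda f(x,\gamma)=\sqrt{\lambda}\sum_{k\in\mathbb{Z}}f(\lambda(x+k))e^{-2\pi i k\gamma}$, $x,\gamma\in\mathbb{R}$. For $g\in L^2(\mathbb{R})$ and $\alpha,\beta>0$, the Gabor system is $\mathcal{G}(g,\alpha,\beta)=\{e^{2\pi i\beta m\cdot}g(\cdot-\alpha k)\}_{k,m\in\mathbb{Z}}$. It is a frame for $L^2(\mathbb{R})$ if there are constants $A,B>0$ with $A\|f\|^2\le\sum_{k,m\in\mathbb{Z}}|\langle f,e^{2\pi i\beta m\cdot}g(\cdot-\alpha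 k)\rangle|^2\le B\|f\|^2$ for all $f\in L^2(\mathbb{R})$. The frame set $\mathscr{F}(g)$ is the set of $(\alpha,\beta)\in\mathbb{R}_{>0}^2$ for which $\mathcal{G}(g,\alpha,\beta)$ is a frame for $L^2(\mathbb{R})$. *)

theory Defs
  imports "HOL-Analysis.Analysis"
begin

definition hermite_const :: "nat \<Rightarrow> real" where
  "hermite_const n = (2 * pi) ^ n * 2 powr (real n - 1 / 2) * fact n"

definition hermite_fun :: "nat \<Rightarrow> real \<Rightarrow> complex" where
  "hermite_fun n x = complex_of_real
     ((- 1) ^ n * hermite_const n powr (- 1 / 2) * exp (pi * x\<^sup>2)
        * (deriv ^^ n) (\<lambda>t. exp (- 2 * pi * t\<^sup>2)) x)"

(* The series is read as an unconditional sum, with the convention that infsum is 0 for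
   a non-summable family. For Hermite functions it converges absolutely at every point. *)
definition zak :: "real \<Rightarrow> (real \<Rightarrow> complex) \<Rightarrow> real \<Rightarrow> real \<Rightarrow> complex" where
  "zak lam f x \<gamma> = complex_of_real (sqrt lam) *
     (\<Sum>\<^sub>\<infinity>k\<in>(UNIV :: int set).
        f (lam * (x + of_int k)) * exp (- 2 * complex_of_real pi * \<i> * of_int k * complex_of_real \<gamma>))"

(* Elements of the space L2 are represented by Borel functions: every Lebesgue measurable
   function agrees almost everywhere with one of these. *)
definition L2_functions :: "(real \<Rightarrow> complex) set" where
  "L2_functions = {f \<in> borel_measurable lborel. integrable lborel (\<lambda>x. (norm (f x))\<^sup>2)}"

definition L2_inner :: "(real \<Rightarrow> complex) \<Rightarrow> (real \<Rightarrow> complex) \<Rightarrow> complex" where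
  "L2_inner f g = (LINT x|lborel. f x * cnj (g x))"

definition L2_norm :: "(real \<Rightarrow> complex) \<Rightarrow> real" where
  "L2_norm f = sqrt (LINT x|lborel. (norm (f x))\<^sup>2)"

definition gabor_system ::
  "(real \<Rightarrow> complex) \<Rightarrow> real \<Rightarrow> real \<Rightarrow> int \<times> int \<Rightarrow> real \<Rightarrow> complex" where
  "gabor_system g \<alpha> \<beta> = (\<lambda>(k, m) x.
     exp (2 * complex_of_real pi * \<i> * complex_of_real \<beta> * of_int m * complex_of_real x)
       * g (x - \<alpha> * of_int k))"

(* Summability is the finiteness implicit in the upper bound; it has to be required
   explicitly because infsum is 0 for a divergent series of nonnegative reals. *)
definition is_frame :: "('i \<Rightarrow> real \<Rightarrow> complex) \<Rightarrow> bool" where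
  "is_frame \<phi> \<longleftrightarrow> (\<exists>A B. A > 0 \<and> B > 0 \<and> (\<forall>f\<in>L2_functions.
     (\<lambda>i. (norm (L2_inner f (\<phi> i)))\<^sup>2) summable_on UNIV \<and>
     A * (L2_norm f)\<^sup>2 \<le> (\<Sum>\<^sub>\<infinity>i. (norm (L2_inner f (\<phi> i)))\<^sup>2) \<and>
     (\<Sum>\<^sub>\<infinity>i. (norm (L2_inner f (\<phi> i)))\<^sup>2) \<le> B * (L2_norm f)\<^sup>2))"

definition frame_set :: "(real \<Rightarrow> complex) \<Rightarrow> (real \<times> real) set" where
  "frame_set g = {(\<alpha>, \<beta>). \<alpha> > 0 \<and> \<beta> > 0 \<and> is_frame (gabor_system g \<alpha> \<beta>)}"

end

theory Submission
  imports Defs "HOL-Probability.Probability" "HOL-Real_Asymp.Real_Asymp"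
begin


text \<open>Up to a positive constant, \<open>h\<^sub>n\<close> is \<open>herm n x = P\<^sub>n x * exp (- pi * x\<^sup>2)\<close> for a rescaled Hermite
polynomial \<open>P\<^sub>n\<close>. The proof has two independent halves, joined by the alternating lattice sums
\<open>herm_sum n \<lambda> y\<close> \<open>= \<Sum> (-1)\<^sup>k herm n (\<lambda> * (k + y))\<close>; up to a positive factor,
\<open>herm_sum n \<lambda> (1/6)\<close> is the value of the Zak transform at \<open>(1/6, 1/2)\<close>.

\<^bold>\<open>A zero beyond \<open>sqrt 3\<close>.\<close> Write \<open>\<lambda> = 6 * x\<close>. Since \<open>n\<close> is even, \<open>herm_sum n \<lambda> (1/6)\<close> is
\<open>herm n x\<close> minus an alternating series whose terms are the values of \<open>herm n\<close> at \<open>5x\<close> and \<open>7x\<close>, at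
\<open>11x\<close> and \<open>13x\<close>, and so on. Past the oscillatory region \<open>herm n\<close> is positive and decreasing, so as soon as
\<open>5x\<close> lies there, Leibniz's criterion puts the sum between \<open>herm n x - herm n (5 * x) - herm n (7 * x)\<close> and
\<open>herm n x\<close> (\<open>herm_sum_bounds\<close>). For large \<open>x\<close> the lower bound is nonnegative. On the other side it suffices
to find \<open>x > sqrt 3 / 6\<close> with \<open>herm n x \<le> 0\<close> and \<open>5x\<close> past the oscillations; such a point exists
(\<open>herm_nonpos_point\<close>) because Sturm comparison with a sine forces \<open>herm n\<close> to vanish in a suitable window.
The intermediate value theorem gives the zero \<open>\<lambda>\<^sub>2\<close>. The six points of the statement need a second zero:
the Fourier transform multiplies \<open>herm n\<close> by \<open>(- \<i>)\<^sup>n\<close>, and Poisson summation then shows that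
\<open>herm_sum n \<lambda> (1/6)\<close> and \<open>herm_sum n (3/\<lambda>) (1/6)\<close> vanish together (\<open>herm_sum_functional_equation\<close>).

\<^bold>\<open>From zeros to failing frames.\<close> Let \<open>L\<close> be \<open>\<lambda>\<^sub>2\<close> or \<open>3/\<lambda>\<^sub>2\<close>. The sum \<open>herm_sum n L y\<close> vanishes at
\<open>y = 1/6\<close>, at \<open>y = 1/2\<close> and \<open>y = 5/6\<close> by the symmetry of \<open>herm n\<close>, hence on \<open>1/6 + \<int>/3\<close>. Thus the formal
comb of point masses \<open>(-1)\<^sup>i\<close> at the points \<open>L * (1/6 + i)\<close> is orthogonal to every translate of \<open>h\<^sub>n\<close> by
a multiple of \<open>L/3\<close>. Modulation by a multiple of \<open>1/L\<close> multiplies all point masses by one common phase, so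
the comb is orthogonal to the whole Gabor system with \<open>\<alpha> = a * L/3\<close> and \<open>\<beta> = b/L\<close>, for all positive integers
\<open>a\<close> and \<open>b\<close>. Spreading the masses over short intervals and cutting the comb off by a wide tent turns it into
square integrable functions that violate the lower frame bound (\<open>not_in_frame_set\<close>). The six points are the
pairs with \<open>(a, b)\<close> equal to \<open>(1, 1)\<close>, \<open>(2, 1)\<close> or \<open>(1, 2)\<close>, for the two values of \<open>L\<close>.\<close>

section \<open>Hermite polynomials and their oscillation\<close>

fun herm_poly :: "nat \<Rightarrow> real \<Rightarrow> real" where
  "herm_poly 0 x = 1"
| "herm_poly (Suc 0) x = 4 * pi * x"
| "herm_poly (Suc (Suc n)) x = 4 * pi * x * herm_poly (Suc n) x - 4 * pi * real (Suc n) * herm_poly n x"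

definition herm :: "nat \<Rightarrow> real \<Rightarrow> real" where
  "herm n x = herm_poly n x * exp (- pi * x\<^sup>2)"

lemma herm_poly_Suc:
  "herm_poly (Suc n) x = 4 * pi * x * herm_poly n x - 4 * pi * real n * herm_poly (n - 1) x"
  by (cases n) auto

lemma herm_Suc: "herm (Suc n) x = 4 * pi * x * herm n x - 4 * pi * real n * herm (n - 1) x"
  by (simp add: herm_def herm_poly_Suc algebra_simps)

lemma DERIV_herm_poly:
  "(herm_poly n has_real_derivative 4 * pi * real n * herm_poly (n - 1) x) (at x)"
proof (induction n x rule: herm_poly.induct)
  case (1 x)
  then show ?case by simp
next
  case (2 x)
  have "((\<lambda>x. 4 * pi * x) has_real_derivative 4 * pi) (at x)"
    by (auto intro!: derivative_eq_intros)
  then show ?case by simp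
next
  case (3 n x)
  have "((\<lambda>x. 4 * pi * x * herm_poly (Suc n) x - 4 * pi * real (Suc n) * herm_poly n x) has_real_derivative
    4 * pi * herm_poly (Suc n) x + 4 * pi * x * (4 * pi * real (Suc n) * herm_poly n x)
     - 4 * pi * real (Suc n) * (4 * pi * real n * herm_poly (n - 1) x)) (at x)"
    using 3 by (auto intro!: derivative_eq_intros)
  also have "4 * pi * herm_poly (Suc n) x + 4 * pi * x * (4 * pi * real (Suc n) * herm_poly n x)
     - 4 * pi * real (Suc n) * (4 * pi * real n * herm_poly (n - 1) x) =
     4 * pi * real (Suc (Suc n)) * herm_poly (Suc n) x"
    by (simp add: herm_poly_Suc[of n] algebra_simps)
  finally show ?case by simp
qed

lemma DERIV_herm: "(herm n has_real_derivative 2 * pi * x * herm n x - herm (Suc n) x) (at x)"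
  unfolding herm_def[abs_def]
  by (auto intro!: derivative_eq_intros DERIV_herm_poly simp: herm_poly_Suc algebra_simps)

lemma DERIV_herm_comp [derivative_intros]:
  assumes "(f has_real_derivative D) (at x within S)"
  shows "((\<lambda>x. herm n (f x)) has_real_derivative
    (2 * pi * f x * herm n (f x) - herm (Suc n) (f x)) * D) (at x within S)"
  using DERIV_chain2[OF DERIV_herm assms] .

lemma continuous_on_herm [continuous_intros]:
  "continuous_on S f \<Longrightarrow> continuous_on S (\<lambda>x. herm n (f x))"
  using continuous_on_compose2[of UNIV "herm n" S f] DERIV_herm
  by (metis DERIV_isCont continuous_at_imp_continuous_on subset_UNIV)

lemma herm_minus: "herm n (- x) = (-1) ^ n * herm n x"
proof -
  have "herm_poly n (- x) = (-1) ^ n * herm_poly n x"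
    by (induction n x rule: herm_poly.induct) (auto simp: algebra_simps)
  then show ?thesis by (simp add: herm_def)
qed

text \<open>The weight in the Rodrigues formula is the square of the Gaussian that \<open>herm\<close> carries; this is why the
recursion of \<open>herm_poly\<close> has the coefficients \<open>4 * pi\<close>.\<close>

lemma higher_deriv_gauss:
  "(deriv ^^ n) (\<lambda>t. exp (- 2 * pi * t\<^sup>2)) = (\<lambda>x. (-1) ^ n * herm_poly n x * exp (- 2 * pi * x\<^sup>2))"
proof (induction n)
  case (Suc n)
  have "((\<lambda>x. (-1) ^ n * herm_poly n x * exp (- 2 * pi * x\<^sup>2)) has_real_derivative
    (-1) ^ Suc n * herm_poly (Suc n) x * exp (- 2 * pi * x\<^sup>2)) (at x)" for x
    by (auto intro!: derivative_eq_intros DERIV_herm_poly simp: herm_poly_Suc algebra_simps)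
  then have "deriv (\<lambda>x. (-1) ^ n * herm_poly n x * exp (- 2 * pi * x\<^sup>2)) =
    (\<lambda>x. (-1) ^ Suc n * herm_poly (Suc n) x * exp (- 2 * pi * x\<^sup>2))"
    by (intro ext DERIV_imp_deriv)
  then show ?case
    using Suc.IH by simp
qed simp

lemma hermite_fun_eq:
  "hermite_fun n x = complex_of_real (hermite_const n powr (- 1 / 2) * herm n x)"
proof -
  have "(- 1) ^ n * hermite_const n powr (- 1 / 2) * exp (pi * x\<^sup>2)
        * ((-1) ^ n * herm_poly n x * exp (- 2 * pi * x\<^sup>2)) =
     ((-1) ^ n * (-1) ^ n) * hermite_const n powr (- 1 / 2) * herm_poly n x * (exp (pi * x\<^sup>2) * exp (- 2 * pi * x\<^sup>2))"
    by (simp add: algebra_simps)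
  also have "exp (pi * x\<^sup>2) * exp (- 2 * pi * x\<^sup>2) = exp (- pi * x\<^sup>2)"
    by (simp flip: exp_add add: algebra_simps)
  also have "(-1) ^ n * (-1) ^ n = (1::real)"
    by (simp flip: power_mult_distrib)
  finally have "(- 1) ^ n * hermite_const n powr (- 1 / 2) * exp (pi * x\<^sup>2)
        * ((-1) ^ n * herm_poly n x * exp (- 2 * pi * x\<^sup>2)) =
     hermite_const n powr (- 1 / 2) * (herm_poly n x * exp (- pi * x\<^sup>2))"
    by simp
  then show ?thesis
    unfolding hermite_fun_def higher_deriv_gauss herm_def by presburger
qed

lemma hermite_const_pos: "hermite_const n > 0"
  by (simp add: hermite_const_def)

text \<open>A polynomial of degree \<open>n\<close> is at most a multiple of \<open>(1 + x\<^sup>2) ^ n\<close>, and one term of the exponential series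
of \<open>exp (1 + x\<^sup>2)\<close> absorbs every power of \<open>1 + x\<^sup>2\<close>; the decay of the Gaussian wins because \<open>pi \<ge> 1\<close>.\<close>

lemma herm_bound: "\<exists>C>0. \<forall>x. \<bar>herm n x\<bar> * (1 + x\<^sup>2) ^ k \<le> C"
proof -
  have "\<exists>C>0. \<forall>x. \<bar>herm_poly n x\<bar> \<le> C * (1 + x\<^sup>2) ^ n"
  proof (induction n rule: induct_nat_012)
    case (ge2 n)
    from ge2 obtain C1 C2 where C: "C1 > 0" "C2 > 0" "\<And>x. \<bar>herm_poly (Suc n) x\<bar> \<le> C1 * (1 + x\<^sup>2) ^ Suc n"
      "\<And>x. \<bar>herm_poly n x\<bar> \<le> C2 * (1 + x\<^sup>2) ^ n" by blast
    have "\<bar>herm_poly (Suc (Suc n)) x\<bar> \<le> (4 * pi * C1 + 4 * pi * real (Suc n) * C2) * (1 + x\<^sup>2) ^ Suc (Suc n)" for x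
    proof -
      have x: "\<bar>x\<bar> \<le> 1 + x\<^sup>2"
        using sum_power2_ge_zero[of "\<bar>x\<bar> - 1" 0] abs_ge_zero[of x]
        by (simp add: power2_diff)
      have "\<bar>4 * pi * x * herm_poly (Suc n) x\<bar> \<le> 4 * pi * (1 + x\<^sup>2) * (C1 * (1 + x\<^sup>2) ^ Suc n)"
        unfolding abs_mult using x C(3)[of x] by (intro mult_mono) auto
      moreover have "\<bar>4 * pi * real (Suc n) * herm_poly n x\<bar> \<le> 4 * pi * real (Suc n) * (C2 * (1 + x\<^sup>2) ^ n)"
        unfolding abs_mult using C(4)[of x] by (intro mult_mono) auto
      moreover have "4 * pi * real (Suc n) * (C2 * (1 + x\<^sup>2) ^ n) \<le> 4 * pi * real (Suc n) * (C2 * (1 + x\<^sup>2) ^ Suc (Suc n))"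
        using C(2) by (intro mult_left_mono power_increasing) auto
      moreover have "\<bar>herm_poly (Suc (Suc n)) x\<bar> \<le> \<bar>4 * pi * x * herm_poly (Suc n) x\<bar> + \<bar>4 * pi * real (Suc n) * herm_poly n x\<bar>"
        by simp
      moreover have "4 * pi * (1 + x\<^sup>2) * (C1 * (1 + x\<^sup>2) ^ Suc n) = 4 * pi * C1 * (1 + x\<^sup>2) ^ Suc (Suc n)"
        by simp
      ultimately show ?thesis
        unfolding distrib_right by (simp only: mult.assoc)
    qed
    moreover have "4 * pi * C1 + 4 * pi * real (Suc n) * C2 > 0"
      using C by (intro add_pos_pos mult_pos_pos) auto
    ultimately show ?case by blast
  next
    case 1
    have "\<bar>herm_poly (Suc 0) x\<bar> \<le> 4 * pi * (1 + x\<^sup>2) ^ Suc 0" for x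
    proof -
      have "\<bar>x\<bar> \<le> 1 + x\<^sup>2"
        using sum_power2_ge_zero[of "\<bar>x\<bar> - 1" 0] abs_ge_zero[of x]
        by (simp add: power2_diff)
      then show ?thesis by (simp add: abs_mult)
    qed
    then show ?case by (intro exI[of _ "4 * pi"]) auto
  qed (auto intro!: exI[of _ 1])
  then obtain C where C: "C > 0" "\<And>x. \<bar>herm_poly n x\<bar> \<le> C * (1 + x\<^sup>2) ^ n" by blast
  have "\<bar>herm n x\<bar> * (1 + x\<^sup>2) ^ k \<le> C * (fact (n + k) * exp 1)" for x
  proof -
    have "(1 + x\<^sup>2) ^ (n + k) / fact (n + k) \<le> exp (1 + x\<^sup>2)"
    proof -
      have "(\<Sum>i\<in>{n+k}. (1 + x\<^sup>2) ^ i /\<^sub>R fact i) \<le> exp (1 + x\<^sup>2)"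
        unfolding exp_def by (rule sum_le_suminf) (use summable_exp_generic[of "1 + x\<^sup>2"] in auto)
      then show ?thesis by (simp add: divide_inverse mult.commute)
    qed
    then have 1: "(1 + x\<^sup>2) ^ (n + k) \<le> fact (n + k) * exp (1 + x\<^sup>2)"
      by (simp add: pos_divide_le_eq mult.commute)
    have 2: "exp (1 + x\<^sup>2) * exp (- pi * x\<^sup>2) \<le> exp 1"
    proof -
      have "1 * x\<^sup>2 \<le> pi * x\<^sup>2" using pi_gt3 by (intro mult_right_mono) auto
      then show ?thesis by (simp flip: exp_add)
    qed
    have "\<bar>herm n x\<bar> * (1 + x\<^sup>2) ^ k = \<bar>herm_poly n x\<bar> * (exp (- pi * x\<^sup>2) * (1 + x\<^sup>2) ^ k)"
      by (simp add: herm_def abs_mult)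
    also have "\<dots> \<le> (C * (1 + x\<^sup>2) ^ n) * (exp (- pi * x\<^sup>2) * (1 + x\<^sup>2) ^ k)"
      by (intro mult_right_mono C(2)) auto
    also have "\<dots> = C * ((1 + x\<^sup>2) ^ (n + k) * exp (- pi * x\<^sup>2))"
      by (simp add: power_add)
    also have "\<dots> \<le> C * ((fact (n + k) * exp (1 + x\<^sup>2)) * exp (- pi * x\<^sup>2))"
      using C(1) 1 by (intro mult_left_mono mult_right_mono) auto
    also have "\<dots> \<le> C * (fact (n + k) * exp 1)"
      using C(1) 2 by (simp add: mult.assoc)
    finally show ?thesis .
  qed
  moreover have "C * (fact (n + k) * exp 1) > 0" using C(1) by simp
  ultimately show ?thesis by blast
qed

text \<open>Once \<open>x\<close> is past the oscillations, the term \<open>4 * pi * x * P\<^sub>k\<close> of the recursion outweighs the subtracted one,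
so the lower bound on the ratio of consecutive polynomials reproduces itself. The factor \<open>3\<close> is a compromise: a
factor above \<open>2\<close> makes even \<open>x * herm n x\<close> decrease, and the threshold it costs is still met by the
points of \<open>herm_nonpos_point\<close>.\<close>

lemma herm_poly_dominant:
  assumes x: "x > 0" and "4 * real n \<le> 3 * pi * x\<^sup>2" and "k \<le> n"
  shows "herm_poly k x > 0 \<and> 3 * pi * x * herm_poly k x \<le> herm_poly (Suc k) x"
  using \<open>k \<le> n\<close>
proof (induction k)
  case 0
  then show ?case using x by simp
next
  case (Suc k)
  then have IH: "herm_poly k x > 0" "3 * pi * x * herm_poly k x \<le> herm_poly (Suc k) x" by auto
  have pos: "herm_poly (Suc k) x > 0"
    using IH x by (intro less_le_trans[OF _ IH(2)]) simp
  have "4 * real (Suc k) \<le> 3 * pi * x\<^sup>2"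
    using Suc.prems assms(2) by simp
  then have "4 * real (Suc k) * herm_poly k x * pi * x \<le> 3 * pi * x\<^sup>2 * herm_poly k x * pi * x"
    using IH x by (intro mult_right_mono) auto
  also have "\<dots> = pi * x\<^sup>2 * (3 * pi * x * herm_poly k x)"
    by (simp add: power2_eq_square)
  also have "\<dots> \<le> pi * x\<^sup>2 * herm_poly (Suc k) x"
    using IH by (intro mult_left_mono) auto
  finally have "x * (4 * pi * real (Suc k) * herm_poly k x) \<le> x * (pi * x * herm_poly (Suc k) x)"
    by (simp add: power2_eq_square algebra_simps)
  then have "4 * pi * real (Suc k) * herm_poly k x \<le> pi * x * herm_poly (Suc k) x"
    using x by (simp add: mult_le_cancel_left_pos)
  then show ?case using pos by (simp add: algebra_simps)
qed

lemma herm_pos: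
  assumes "x > 0" "4 * real n \<le> 3 * pi * x\<^sup>2"
  shows "herm n x > 0"
  using herm_poly_dominant[OF assms, of n] by (simp add: herm_def)

lemma herm_Suc_ge:
  assumes "x > 0" "4 * real n \<le> 3 * pi * x\<^sup>2"
  shows "3 * pi * x * herm n x \<le> herm (Suc n) x"
proof -
  have "3 * pi * x * herm_poly n x * exp (- pi * x\<^sup>2) \<le> herm_poly (Suc n) x * exp (- pi * x\<^sup>2)"
    using herm_poly_dominant[OF assms, of n] by (intro mult_right_mono) auto
  then show ?thesis unfolding herm_def by (simp only: mult.assoc)
qed

lemma beyond_threshold:
  assumes "0 < x" "x \<le> y" "4 * real n \<le> 3 * pi * x\<^sup>2"
  shows "4 * real n \<le> 3 * pi * y\<^sup>2"
proof -
  have "3 * pi * x\<^sup>2 \<le> 3 * pi * y\<^sup>2"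
    using assms by (intro mult_left_mono power_mono) auto
  then show ?thesis using assms by linarith
qed

lemma herm_antimono:
  assumes "0 < x" "x \<le> y" "4 * real n \<le> 3 * pi * x\<^sup>2"
  shows "herm n y \<le> herm n x"
proof (rule DERIV_nonpos_imp_nonincreasing[OF \<open>x \<le> y\<close>])
  fix t assume t: "x \<le> t" "t \<le> y"
  then have *: "t > 0" "4 * real n \<le> 3 * pi * t\<^sup>2"
    using beyond_threshold[OF assms(1) t(1) assms(3)] assms(1) by auto
  have "0 \<le> pi * t * herm n t"
    using herm_pos[OF *] *(1) by simp
  then have "2 * pi * t * herm n t - herm (Suc n) t \<le> 0"
    using herm_Suc_ge[OF *] by (simp add: algebra_simps)
  then show "\<exists>D. (herm n has_real_derivative D) (at t) \<and> D \<le> 0"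
    using DERIV_herm by blast
qed

lemma herm_times_x_antimono:
  assumes "0 < x" "x \<le> y" "4 * real n \<le> 3 * pi * x\<^sup>2" "n > 0"
  shows "y * herm n y \<le> x * herm n x"
proof (rule DERIV_nonpos_imp_nonincreasing[OF \<open>x \<le> y\<close>, of "\<lambda>x. x * herm n x"])
  fix t assume t: "x \<le> t" "t \<le> y"
  then have *: "t > 0" "4 * real n \<le> 3 * pi * t\<^sup>2"
    using beyond_threshold[OF assms(1) t(1) assms(3)] assms(1) by auto
  have "t * (3 * pi * t * herm n t) \<le> t * herm (Suc n) t"
    using herm_Suc_ge[OF *] *(1) by (intro mult_left_mono) auto
  moreover have "1 * herm n t \<le> (pi * t\<^sup>2) * herm n t"
  proof (rule mult_right_mono)
    have "real n \<ge> 1" using \<open>n > 0\<close> by simp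
    then show "1 \<le> pi * t\<^sup>2" using *(2) by linarith
  qed (use herm_pos[OF *] in auto)
  ultimately have "herm n t + t * (2 * pi * t * herm n t - herm (Suc n) t) \<le> 0"
    by (simp add: algebra_simps power2_eq_square)
  moreover have "((\<lambda>x. x * herm n x) has_real_derivative herm n t + t * (2 * pi * t * herm n t - herm (Suc n) t)) (at t)"
    by (auto intro!: derivative_eq_intros)
  ultimately show "\<exists>D. ((\<lambda>x. x * herm n x) has_real_derivative D) (at t) \<and> D \<le> 0"
    by blast
qed

text \<open>Sturm comparison. The function satisfies \<open>h'' = (4 * pi\<^sup>2 * x\<^sup>2 - 2 * pi * (2 * n + 1)) * h\<close>, and the
assumption says that it oscillates at least as fast as \<open>sin (K * (x - a))\<close> throughout one half-period of that sine. If
it stayed positive there, the Wronskian of the two would decrease from a negative to a positive value.\<close>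

lemma herm_nonpos_in_window:
  assumes K: "K > 0" "K\<^sup>2 \<le> 2 * pi * (2 * real n + 1) - 4 * pi\<^sup>2 * (a + pi / K)\<^sup>2" and "a \<ge> 0"
  shows "\<exists>x\<in>{a..a + pi / K}. herm n x \<le> 0"
proof (rule ccontr)
  assume "\<not> ?thesis"
  then have pos: "\<And>x. a \<le> x \<Longrightarrow> x \<le> a + pi / K \<Longrightarrow> herm n x > 0" by force
  define h where "h = herm n"
  define h' where "h' x = 2 * pi * x * herm n x - herm (Suc n) x" for x
  define W where "W x = h' x * sin (K * (x - a)) - h x * (K * cos (K * (x - a)))" for x
  have h'': "(h' has_real_derivative (4 * pi\<^sup>2 * x\<^sup>2 - 2 * pi * (2 * real n + 1)) * h x) (at x)" for x
    unfolding h'_def h_def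
    by (auto intro!: derivative_eq_intros simp: herm_Suc[of "Suc n"] algebra_simps power2_eq_square)
  have h1: "(h has_real_derivative h' x) (at x)" for x
    unfolding h'_def h_def by (rule DERIV_herm)
  have W': "(W has_real_derivative (K\<^sup>2 + 4 * pi\<^sup>2 * x\<^sup>2 - 2 * pi * (2 * real n + 1)) * h x * sin (K * (x - a))) (at x)" for x
    unfolding W_def
    by (auto intro!: derivative_eq_intros h'' h1 simp: algebra_simps power2_eq_square)
  have "W (a + pi / K) \<le> W a"
  proof (rule DERIV_nonpos_imp_nonincreasing[of a "a + pi / K" W])
    show "a \<le> a + pi / K" using K by simp
  next
    fix x assume x: "a \<le> x" "x \<le> a + pi / K"
    have "4 * pi\<^sup>2 * x\<^sup>2 \<le> 4 * pi\<^sup>2 * (a + pi / K)\<^sup>2"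
      using x \<open>a \<ge> 0\<close> by (intro mult_left_mono power_mono) auto
    then have 1: "K\<^sup>2 + 4 * pi\<^sup>2 * x\<^sup>2 - 2 * pi * (2 * real n + 1) \<le> 0" using K by linarith
    have "K * (x - a) \<le> pi" using x K by (simp add: field_simps)
    then have "sin (K * (x - a)) \<ge> 0" using x K by (intro sin_ge_zero) auto
    then have "h x * sin (K * (x - a)) \<ge> 0" using pos[OF x] by (simp add: h_def)
    then have "(K\<^sup>2 + 4 * pi\<^sup>2 * x\<^sup>2 - 2 * pi * (2 * real n + 1)) * h x * sin (K * (x - a)) \<le> 0"
      using 1 by (metis mult.assoc mult_nonpos_nonneg)
    then show "\<exists>D. (W has_real_derivative D) (at x) \<and> D \<le> 0" using W' by blast
  qed
  moreover have "W a = - herm n a * K" by (simp add: W_def h_def)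
  moreover have "W (a + pi / K) = herm n (a + pi / K) * K" using K by (simp add: W_def h_def)
  moreover have "herm n a * K > 0" "herm n (a + pi / K) * K > 0"
    using pos[of a] pos[of "a + pi / K"] K by auto
  ultimately show False by linarith
qed

text \<open>The window has to begin beyond \<open>sqrt 3 / 6\<close> and beyond one fifth of the threshold of \<open>herm_pos\<close>. For
\<open>n \<ge> 6\<close> the window starting at \<open>sqrt (n / (16 * pi))\<close> with \<open>K\<^sup>2 = 2 * pi * n\<close> fits. For \<open>n = 4\<close> no
window starting beyond \<open>sqrt 3 / 6\<close> meets the assumption of \<open>herm_nonpos_in_window\<close>, but \<open>x\<^sup>2 = 1 / (2 * pi)\<close> gives the explicit
value \<open>- 80 * pi\<^sup>2\<close> of the polynomial. For \<open>n = 2\<close> the statement is false: the only positive zero is just below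
\<open>sqrt 3 / 6\<close>.\<close>

lemma herm_nonpos_point:
  assumes "n \<ge> 4" "even n"
  shows "\<exists>x>sqrt 3 / 6. herm n x \<le> 0 \<and> 4 * real n \<le> 3 * pi * (5 * x)\<^sup>2"
proof (cases "n = 4")
  case True
  define x where "x = sqrt (1 / (2 * pi))"
  have x2: "x\<^sup>2 = 1 / (2 * pi)" by (simp add: x_def)
  have "(sqrt 3 / 6)\<^sup>2 < x\<^sup>2"
    unfolding x2 using pi_less_4 by (simp add: power_divide field_simps)
  then have "sqrt 3 / 6 < x"
    by (rule power2_less_imp_less) (simp add: x_def)
  moreover have "herm n x \<le> 0"
  proof -
    have "herm_poly n x = 256 * pi ^ 4 * (x\<^sup>2)\<^sup>2 - 384 * pi ^ 3 * x\<^sup>2 + 48 * pi\<^sup>2"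
      unfolding True by (simp add: eval_nat_numeral algebra_simps)
    also have "\<dots> = - 80 * pi\<^sup>2"
      unfolding x2 by (simp add: field_simps eval_nat_numeral)
    finally show ?thesis
      by (simp add: herm_def mult_nonpos_nonneg)
  qed
  moreover have "4 * real n \<le> 3 * pi * (5 * x)\<^sup>2"
    using True by (simp add: power_mult_distrib x2)
  ultimately show ?thesis by blast
next
  case False
  with assms have n: "n \<ge> 6" by presburger
  define s where "s = sqrt (real n)"
  define p where "p = sqrt pi"
  have s2: "s\<^sup>2 = real n" and p2: "p\<^sup>2 = pi" and p0: "p > 0" and s0: "s > 0"
    using n by (auto simp: s_def p_def)
  define a where "a = s / (4 * p)"
  define K where "K = sqrt 2 * p * s"
  have K0: "K > 0" using p0 s0 by (simp add: K_def)
  have piK: "pi / K = p / (sqrt 2 * s)"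
    unfolding K_def p2[symmetric] using p0 s0 by (simp add: field_simps power2_eq_square)
  have a0: "a \<ge> 0" using p0 s0 by (simp add: a_def)
  have bound: "a + pi / K \<le> s / (sqrt 2 * p)"
  proof -
    have "sqrt 2 * s\<^sup>2 + 4 * p\<^sup>2 \<le> 4 * s\<^sup>2"
    proof -
      have "sqrt 2 \<le> 3 / 2" by (rule real_le_lsqrt) (auto simp: power2_eq_square)
      then have "sqrt 2 * real n \<le> 3 / 2 * real n" by (intro mult_right_mono) auto
      moreover have "pi \<le> 16 / 5" using pi_approx by simp
      moreover have "real n \<ge> 6" using n by simp
      ultimately show ?thesis unfolding s2 p2 by linarith
    qed
    then have "(sqrt 2 * s\<^sup>2 + 4 * p\<^sup>2) / (4 * sqrt 2 * p * s) \<le> 4 * s\<^sup>2 / (4 * sqrt 2 * p * s)"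
      using p0 s0 by (intro divide_right_mono) auto
    moreover have "(sqrt 2 * s\<^sup>2 + 4 * p\<^sup>2) / (4 * sqrt 2 * p * s) = a + pi / K"
      unfolding piK a_def add_divide_distrib using p0 s0 by (simp add: power2_eq_square)
    moreover have "4 * s\<^sup>2 / (4 * sqrt 2 * p * s) = s / (sqrt 2 * p)"
      using p0 s0 by (simp add: power2_eq_square)
    ultimately show ?thesis by simp
  qed
  have "(a + pi / K)\<^sup>2 \<le> (s / (sqrt 2 * p))\<^sup>2"
    using bound a0 K0 by (intro power_mono) auto
  also have "\<dots> = real n / (2 * pi)"
    by (simp add: power_divide power_mult_distrib s2 p2)
  finally have "4 * pi\<^sup>2 * (a + pi / K)\<^sup>2 \<le> 4 * pi\<^sup>2 * (real n / (2 * pi))"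
    by (intro mult_left_mono) auto
  then have "4 * pi\<^sup>2 * (a + pi / K)\<^sup>2 \<le> 2 * pi * real n"
    by (simp add: power2_eq_square)
  moreover have "2 * pi * (2 * real n + 1) = 2 * pi * real n + 2 * pi * real n + 2 * pi"
    by (simp add: algebra_simps)
  moreover have "K\<^sup>2 = 2 * pi * real n"
    by (simp add: K_def power_mult_distrib s2 p2)
  ultimately have "K\<^sup>2 \<le> 2 * pi * (2 * real n + 1) - 4 * pi\<^sup>2 * (a + pi / K)\<^sup>2"
    using pi_gt_zero by linarith
  from herm_nonpos_in_window[OF K0 this a0] obtain x where x: "a \<le> x" "herm n x \<le> 0" by auto
  have a2: "a\<^sup>2 = real n / (16 * pi)"
    by (simp add: a_def power_divide power_mult_distrib s2 p2)
  have ax: "a\<^sup>2 \<le> x\<^sup>2" using x a0 by (intro power_mono) auto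
  have "(sqrt 3 / 6)\<^sup>2 < a\<^sup>2"
    unfolding a2 using pi_less_4 n by (simp add: power_divide field_simps)
  then have "sqrt 3 / 6 < a" using a0 by (rule power2_less_imp_less)
  moreover have "4 * real n \<le> 3 * pi * (5 * x)\<^sup>2"
  proof -
    have "4 * real n \<le> 75 * pi * a\<^sup>2" unfolding a2 by simp
    also have "\<dots> \<le> 75 * pi * x\<^sup>2" using ax by (intro mult_left_mono) auto
    finally show ?thesis by (simp add: power_mult_distrib)
  qed
  ultimately show ?thesis using x by (intro exI[of _ x]) auto
qed


section \<open>Lattice sums and the Bessel inequality\<close>

text \<open>Uniformity in the offset \<open>a\<close> is what matters: after subtracting the index nearest to \<open>a / s\<close>, the distance of
the lattice point from \<open>a\<close> is at least half of its distance from the nearest one.\<close>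

lemma lattice_sums_bounded:
  fixes s :: real
  assumes "s > 0"
  obtains M where "M > 0"
    "\<And>a (K :: int set). finite K \<Longrightarrow> (\<Sum>k\<in>K. 1 / (1 + (s * of_int k - a)\<^sup>2)) \<le> M"
proof -
  define G where "G m = 1 / (1 + s\<^sup>2 * (real m)\<^sup>2 / 4)" for m :: nat
  have G0: "G m \<ge> 0" for m by (simp add: G_def)
  have "summable G"
  proof (rule summable_comparison_test'[where N = 1 and g = "\<lambda>m. (4 / s\<^sup>2) * inverse (real m ^ 2)"])
    show "summable (\<lambda>m. (4 / s\<^sup>2) * inverse (real m ^ 2))"
      by (intro summable_mult inverse_power_summable) auto
    show "norm (G m) \<le> (4 / s\<^sup>2) * inverse (real m ^ 2)" if "m \<ge> 1" for m
    proof -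
      have "G m \<le> 1 / (s\<^sup>2 * (real m)\<^sup>2 / 4)"
        unfolding G_def using that assms by (intro divide_left_mono) (auto intro!: mult_pos_pos add_pos_nonneg)
      then show ?thesis using G0[of m] by (simp add: field_simps)
    qed
  qed
  define g where "g k = G (nat \<bar>k\<bar>)" for k :: int
  have half: "(\<Sum>k\<in>K. g k) \<le> suminf G" if "finite K" "inj_on (\<lambda>k. nat \<bar>k\<bar>) K" for K
  proof -
    have "(\<Sum>k\<in>K. g k) = (\<Sum>m\<in>(\<lambda>k. nat \<bar>k\<bar>) ` K. G m)"
      using that by (subst sum.reindex) (auto simp: g_def)
    also have "\<dots> \<le> suminf G"
      using that G0 \<open>summable G\<close> by (intro sum_le_suminf) auto
    finally show ?thesis .
  qed
  have g_sum: "(\<Sum>k\<in>K. g k) \<le> 2 * suminf G + 1" if "finite K" for K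
  proof -
    have "K = {k\<in>K. k \<ge> 0} \<union> {k\<in>K. k < 0}" by auto
    then have "(\<Sum>k\<in>K. g k) = (\<Sum>k\<in>{k\<in>K. k \<ge> 0}. g k) + (\<Sum>k\<in>{k\<in>K. k < 0}. g k)"
      using that by (subst (1) \<open>K = _\<close>, subst sum.union_disjoint) auto
    also have "\<dots> \<le> suminf G + suminf G"
      using that by (intro add_mono half) (auto simp: inj_on_def)
    finally show ?thesis by simp
  qed
  have shift: "1 / (1 + (s * of_int k - a)\<^sup>2) \<le> g (k - round (a / s))" for k a
  proof -
    define d where "d = k - round (a / s)"
    define r where "r = a - s * of_int (round (a / s))"
    have "\<bar>a / s - of_int (round (a / s))\<bar> \<le> 1 / 2"
      using of_int_round_abs_le[of "a / s"] by (simp add: abs_minus_commute)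
    then have "s * \<bar>a / s - of_int (round (a / s))\<bar> \<le> s * (1 / 2)"
      using assms by (intro mult_left_mono) auto
    also have "s * \<bar>a / s - of_int (round (a / s))\<bar> = \<bar>s * (a / s - of_int (round (a / s)))\<bar>"
      using assms by (simp add: abs_mult)
    also have "s * (a / s - of_int (round (a / s))) = r"
      using assms by (simp add: r_def right_diff_distrib)
    finally have r: "\<bar>r\<bar> \<le> s / 2" by simp
    have eq: "s * of_int k - a = s * of_int d - r"
      by (simp add: d_def r_def algebra_simps)
    have "s * \<bar>of_int d\<bar> / 2 \<le> \<bar>s * of_int d - r\<bar>"
    proof (cases "d = 0")
      case False
      then have "s * 1 \<le> s * \<bar>of_int d\<bar>"
        using assms by (intro mult_left_mono) linarith+
      moreover have "\<bar>s * of_int d\<bar> = s * \<bar>of_int d\<bar>" using assms by (simp add: abs_mult)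
      ultimately show ?thesis using r by linarith
    qed auto
    then have "(s * \<bar>of_int d\<bar> / 2)\<^sup>2 \<le> \<bar>s * of_int d - r\<bar>\<^sup>2"
      using assms by (intro power_mono) auto
    then have "1 + s\<^sup>2 * (real (nat \<bar>d\<bar>))\<^sup>2 / 4 \<le> 1 + (s * of_int k - a)\<^sup>2"
      unfolding eq by (simp add: power_mult_distrib power_divide)
    then show ?thesis
      unfolding g_def G_def d_def[symmetric] by (intro divide_left_mono) (auto intro!: mult_pos_pos add_pos_nonneg)
  qed
  show ?thesis
  proof (rule that[of "2 * suminf G + 1"])
    show "2 * suminf G + 1 > 0"
      using suminf_nonneg[OF \<open>summable G\<close> G0] by linarith
    fix a :: real and K :: "int set" assume "finite K"
    have "(\<Sum>k\<in>K. 1 / (1 + (s * of_int k - a)\<^sup>2)) \<le> (\<Sum>k\<in>K. g (k - round (a / s)))"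
      by (intro sum_mono shift)
    also have "\<dots> = (\<Sum>k\<in>(\<lambda>k. k - round (a / s)) ` K. g k)"
      by (subst sum.reindex) (auto simp: inj_on_def)
    also have "\<dots> \<le> 2 * suminf G + 1" using \<open>finite K\<close> by (intro g_sum) auto
    finally show "(\<Sum>k\<in>K. 1 / (1 + (s * of_int k - a)\<^sup>2)) \<le> 2 * suminf G + 1" .
  qed
qed

lemma lattice_summable:
  fixes s a :: real
  assumes "s > 0"
  shows "(\<lambda>k::int. 1 / (1 + (s * of_int k - a)\<^sup>2)) summable_on UNIV"
proof -
  obtain M where M: "\<And>a (K :: int set). finite K \<Longrightarrow> (\<Sum>k\<in>K. 1 / (1 + (s * of_int k - a)\<^sup>2)) \<le> M"
    using lattice_sums_bounded[OF assms] by metis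
  show ?thesis
    using M by (intro nonneg_bdd_above_summable_on bdd_aboveI2[where M = M]) auto
qed

lemma lattice_abs_summable:
  fixes f :: "int \<Rightarrow> 'a::banach"
  assumes "s > 0" "\<And>k. norm (f k) \<le> C / (1 + (s * of_int k - a)\<^sup>2)"
  shows "(\<lambda>k. norm (f k)) summable_on UNIV" "f summable_on UNIV"
proof -
  have "(\<lambda>k::int. C * (1 / (1 + (s * of_int k - a)\<^sup>2))) summable_on UNIV"
    by (intro summable_on_cmult_right lattice_summable assms)
  then show 1: "(\<lambda>k. norm (f k)) summable_on UNIV"
    by (rule summable_on_comparison_test) (use assms(2) in auto)
  then show "f summable_on UNIV" by (rule abs_summable_summable)
qed

lemma filterlim_int_intervals:
  "filterlim (\<lambda>N. {- int N..int N}) (finite_subsets_at_top UNIV) sequentially"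
  "filterlim (\<lambda>N. {- int N..<int N}) (finite_subsets_at_top UNIV) sequentially"
proof -
  have "\<exists>N. X \<subseteq> {- int N..<int N}" if "finite X" for X :: "int set"
  proof -
    have "finite (abs ` X)" using that by simp
    then obtain B where B: "\<forall>x\<in>abs ` X. x \<le> B" using bdd_above_finite[of "abs ` X"] by (auto simp: bdd_above_def)
    then have "X \<subseteq> {- int (nat (B + 1))..<int (nat (B + 1))}" by force
    then show ?thesis by blast
  qed
  then have *: "\<exists>N. \<forall>n\<ge>N. X \<subseteq> {- int n..<int n}" if "finite X" for X :: "int set"
    using that by (meson atLeastLessThan_subset_iff dual_order.trans of_nat_mono neg_le_iff_le ivl_subset)
  show "filterlim (\<lambda>N. {- int N..<int N}) (finite_subsets_at_top UNIV) sequentially"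
    unfolding filterlim_finite_subsets_at_top eventually_sequentially using * by auto
  have "{- int n..<int n} \<subseteq> {- int n..int n}" for n by auto
  then have "\<exists>N. \<forall>n\<ge>N. X \<subseteq> {- int n..int n}" if "finite X" for X :: "int set"
    using *[OF that] by (meson order_trans)
  then show "filterlim (\<lambda>N. {- int N..int N}) (finite_subsets_at_top UNIV) sequentially"
    unfolding filterlim_finite_subsets_at_top eventually_sequentially by auto
qed

lemma borel_measurable_cis [measurable]:
  "f \<in> borel_measurable M \<Longrightarrow> (\<lambda>x. cis (f x)) \<in> borel_measurable M"
  by (rule borel_measurable_continuous_on[where f = cis]) (auto intro: continuous_intros)

lemma borel_measurable_cnj [measurable]:
  "f \<in> borel_measurable M \<Longrightarrow> (\<lambda>x. cnj (f x)) \<in> borel_measurable M"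
  by (rule borel_measurable_continuous_on[where f = cnj]) (auto intro: continuous_intros)

lemma cis_int_period: "cis (2 * pi * of_int m * of_int k) = 1"
proof -
  have "cis (2 * pi * of_int (m * k)) = 1" by (intro cis_multiple_2pi) auto
  then show ?thesis by (simp add: mult.assoc)
qed

lemma has_bochner_integral_character:
  fixes a T :: real and m :: int
  assumes "T > 0"
  shows "has_bochner_integral lborel (\<lambda>x. indicator {a..a + T} x *\<^sub>R cis (2 * pi * of_int m * x / T))
    (if m = 0 then complex_of_real T else 0)"
proof (cases "m = 0")
  case True
  have "has_bochner_integral lborel (\<lambda>x. indicator {a..a + T} x *\<^sub>R (1::complex)) (of_real (a + T) - of_real a)"
    by (intro has_bochner_integral_FTC_Icc) (use assms in \<open>auto intro!: derivative_eq_intros\<close>)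
  then show ?thesis using True by simp
next
  case False
  define t where "t = 2 * pi * of_int m / T"
  have t: "t \<noteq> 0" using False assms by (simp add: t_def)
  have "has_bochner_integral lborel (\<lambda>x. indicator {a..a + T} x *\<^sub>R cis (t * x))
     (cis (t * (a + T)) / (\<i> * of_real t) - cis (t * a) / (\<i> * of_real t))"
  proof (rule has_bochner_integral_FTC_Icc)
    show "((\<lambda>x. cis (t * x) / (\<i> * of_real t)) has_vector_derivative cis (t * x)) (at x within {a..a + T})" for x
      unfolding has_vector_derivative_def
      by (rule derivative_eq_intros refl)+ (use t in \<open>auto simp: scaleR_conv_of_real fun_eq_iff complex_eq_iff\<close>)
  qed (use assms in \<open>auto intro!: continuous_intros\<close>)
  moreover have "cis (t * (a + T)) = cis (t * a)"
  proof -
    have "t * (a + T) = t * a + 2 * pi * of_int m" using assms by (simp add: t_def field_simps)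
    then show ?thesis using cis_multiple_2pi[of "of_int m"] by (simp flip: cis_mult)
  qed
  ultimately show ?thesis using False by (simp add: t_def mult.assoc)
qed

text \<open>The usual argument: the square integral of \<open>u\<close> minus its Fourier polynomial over the indices \<open>M\<close> is nonnegative, and
expanding it leaves exactly the difference of the two sides.\<close>

lemma bessel_inequality:
  fixes u :: "real \<Rightarrow> complex" and T a B :: real and M :: "int set"
  assumes T: "T > 0" and [measurable]: "u \<in> borel_measurable lborel"
    and B: "\<And>x. norm (u x) \<le> B" and supp: "\<And>x. x \<notin> {a..a + T} \<Longrightarrow> u x = 0" and "finite M"
  shows "(\<Sum>m\<in>M. (norm (LINT x|lborel. u x * cis (- (2 * pi * of_int m * x / T))))\<^sup>2)
    \<le> T * (LINT x|lborel. (norm (u x))\<^sup>2)"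
proof -
  define I where "I = {a..a + T}"
  define w where "w m x = indicator I x *\<^sub>R cis (2 * pi * of_int m * x / T)" for m :: int and x
  define A where "A m = (LINT x|lborel. u x * cis (- (2 * pi * of_int m * x / T)))" for m :: int
  define U where "U = (LINT x|lborel. (norm (u x))\<^sup>2)"
  have [measurable]: "I \<in> sets borel" by (simp add: I_def)
  have w_meas [measurable]: "w m \<in> borel_measurable lborel" for m unfolding w_def by measurable
  have dominated: "integrable lborel v" if [measurable]: "v \<in> borel_measurable lborel" and "\<And>x. norm (v x) \<le> D * indicator I x"
    for v :: "real \<Rightarrow> complex" and D
  proof (rule Bochner_Integration.integrable_bound[where f = "\<lambda>x. D * indicator I x"])
    show "integrable lborel (\<lambda>x. D * indicat_real I x)"
      by (intro integrable_mult_right integrable_real_indicator) (auto simp: I_def emeasure_lborel_Icc_eq)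
  qed (use that in \<open>auto intro!: AE_I2 order_trans[OF that(2)]\<close>)
  have uB: "norm (u x) \<le> B * indicator I x" for x
    using B[of x] supp[of x] by (auto simp: I_def split: split_indicator)
  have "0 \<le> B" using B[of 0] norm_ge_zero order_trans by blast
  have wB: "norm (w m x) \<le> 1" "norm (w m x) \<le> indicator I x" for m x by (auto simp: w_def split: split_indicator)
  have uw: "u x * cnj (w m x) = u x * cis (- (2 * pi * of_int m * x / T))" for m x
    using supp[of x] by (auto simp: w_def I_def cis_cnj split: split_indicator)
  have int_uw: "integrable lborel (\<lambda>x. u x * cnj (w m x))" for m
  proof (rule dominated)
    fix x show "norm (u x * cnj (w m x)) \<le> B * indicator I x"
      using mult_mono[OF uB[of x] wB(1)[of m x]] \<open>0 \<le> B\<close> by (auto simp: norm_mult split: split_indicator)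
  qed measurable
  have 1: "has_bochner_integral lborel (\<lambda>x. u x * cnj (w m x)) (A m)" for m
    using int_uw[of m] by (simp add: has_bochner_integral_iff uw A_def)
  have 2: "has_bochner_integral lborel (\<lambda>x. cnj (u x) * w m x) (cnj (A m))" for m
    using has_bochner_integral_bounded_linear[OF bounded_linear_cnj 1[of m]] by simp
  have 3: "has_bochner_integral lborel (\<lambda>x. w m x * cnj (w l x)) (if m = l then of_real T else 0)" for m l
  proof -
    have "w m x * cnj (w l x) = indicator {a..a + T} x *\<^sub>R cis (2 * pi * of_int (m - l) * x / T)" for x
      by (auto simp: w_def I_def cis_cnj cis_mult diff_divide_distrib algebra_simps split: split_indicator)
    then show ?thesis using has_bochner_integral_character[OF T, of a "m - l"] by (simp add: fun_eq_iff)
  qed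
  have int_u2: "integrable lborel (\<lambda>x. u x * cnj (u x))"
  proof (rule dominated)
    fix x show "norm (u x * cnj (u x)) \<le> (B * B) * indicator I x"
      using mult_mono[OF uB[of x] uB[of x]] \<open>0 \<le> B\<close> by (auto simp: norm_mult split: split_indicator)
  qed measurable
  have normsq: "z * cnj z = of_real ((norm z)\<^sup>2)" for z :: complex
    using complex_norm_square[of z] by simp
  have 4: "has_bochner_integral lborel (\<lambda>x. u x * cnj (u x)) (of_real U)"
    unfolding has_bochner_integral_iff using int_u2 by (simp add: normsq U_def flip: integral_complex_of_real)
  define v where "v x = u x - (\<Sum>m\<in>M. A m * w m x) / of_real T" for x
  have expand: "v x * cnj (v x) = u x * cnj (u x)
      - (\<Sum>m\<in>M. cnj (A m) * (u x * cnj (w m x))) / of_real T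
      - (\<Sum>m\<in>M. A m * (cnj (u x) * w m x)) / of_real T
      + (\<Sum>m\<in>M. \<Sum>l\<in>M. (A m * cnj (A l)) * (w m x * cnj (w l x))) / of_real (T * T)" for x
    unfolding v_def
    by (simp add: algebra_simps sum_distrib_left sum_distrib_right sum_product diff_divide_distrib mult.commute)
      (rule disjI2, rule sum.swap)
  have "has_bochner_integral lborel (\<lambda>x. v x * cnj (v x)) (of_real U
      - (\<Sum>m\<in>M. cnj (A m) * A m) / of_real T
      - (\<Sum>m\<in>M. A m * cnj (A m)) / of_real T
      + (\<Sum>m\<in>M. \<Sum>l\<in>M. (A m * cnj (A l)) * (if m = l then of_real T else 0)) / of_real (T * T))"
    unfolding expand
    by (intro has_bochner_integral_add has_bochner_integral_diff has_bochner_integral_divide_zero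
        has_bochner_integral_sum has_bochner_integral_mult_right 1 2 3 4)
  moreover have "(\<Sum>m\<in>M. \<Sum>l\<in>M. (A m * cnj (A l)) * (if m = l then of_real T else 0)) / of_real (T * T)
     = (\<Sum>m\<in>M. A m * cnj (A m)) / of_real T"
  proof -
    have "(\<Sum>l\<in>M. (A m * cnj (A l)) * (if m = l then of_real T else 0)) = A m * cnj (A m) * of_real T" if "m \<in> M" for m
      using \<open>finite M\<close> that by (simp add: sum.delta if_distrib cong: if_cong)
    then show ?thesis
      using T by (simp flip: sum_distrib_right)
  qed
  ultimately have "has_bochner_integral lborel (\<lambda>x. complex_of_real ((norm (v x))\<^sup>2))
      (of_real U - (\<Sum>m\<in>M. A m * cnj (A m)) / of_real T)"
    by (simp add: normsq mult.commute[of "cnj _"])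
  then have "has_bochner_integral lborel (\<lambda>x. complex_of_real ((norm (v x))\<^sup>2))
      (of_real (U - (\<Sum>m\<in>M. (norm (A m))\<^sup>2) / T))"
    by (simp add: normsq)
  then have "(LINT x|lborel. (norm (v x))\<^sup>2) = U - (\<Sum>m\<in>M. (norm (A m))\<^sup>2) / T"
    by (metis has_bochner_integral_iff integral_complex_of_real of_real_eq_iff)
  moreover have "(LINT x|lborel. (norm (v x))\<^sup>2) \<ge> 0" by simp
  ultimately have "(\<Sum>m\<in>M. (norm (A m))\<^sup>2) / T \<le> U" by simp
  then have "(\<Sum>m\<in>M. (norm (A m))\<^sup>2) \<le> T * U"
    using T by (simp add: pos_divide_le_eq mult.commute)
  then show ?thesis unfolding U_def A_def .
qed

text \<open>The weight \<open>1 / (1 + x\<^sup>2)\<close> changes by at most the factor \<open>3\<close> over a distance \<open>1\<close>, so the mean value inequality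
keeps the decay of the derivative. This is what allows summing increments over a lattice.\<close>

lemma lipschitz_with_weight:
  fixes f :: "real \<Rightarrow> 'a::real_normed_vector"
  assumes der: "\<And>x. (f has_vector_derivative f' x) (at x)"
    and C: "\<And>x. norm (f' x) \<le> C / (1 + x\<^sup>2)" and xy: "\<bar>x - y\<bar> \<le> 1"
  shows "norm (f x - f y) \<le> (3 * C) * \<bar>x - y\<bar> / (1 + y\<^sup>2)"
proof -
  have "0 \<le> C" using order_trans[OF norm_ge_zero C[of 0]] by simp
  have bound: "norm (f' t) \<le> 3 * C / (1 + y\<^sup>2)" if "t \<in> closed_segment y x" for t
  proof -
    have "\<bar>t - y\<bar> \<le> 1" using that xy by (auto simp: closed_segment_eq_real_ivl split: if_splits)
    then have "(t - y)\<^sup>2 \<le> 1" by (simp add: abs_square_le_1)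
    moreover have "y\<^sup>2 \<le> 2 * t\<^sup>2 + 2 * (t - y)\<^sup>2"
      using zero_le_power2[of "2 * t - y"] by (simp add: power2_eq_square algebra_simps)
    ultimately have "1 + y\<^sup>2 \<le> 3 + 3 * t\<^sup>2" using zero_le_power2[of t] by linarith
    then have "1 + y\<^sup>2 \<le> 3 * (1 + t\<^sup>2)" by (simp only: distrib_left mult_1_right)
    then have a: "3 * C / (3 * (1 + t\<^sup>2)) \<le> 3 * C / (1 + y\<^sup>2)"
      using \<open>0 \<le> C\<close> by (intro divide_left_mono) (auto intro!: mult_pos_pos add_pos_nonneg)
    have b: "3 * C / (3 * (1 + t\<^sup>2)) = C / (1 + t\<^sup>2)"
      by (rule mult_divide_mult_cancel_left) simp
    show ?thesis using C[of t] a unfolding b by (rule order_trans)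
  qed
  have "norm (f x - f y) \<le> 3 * C / (1 + y\<^sup>2) * norm (x - y)"
  proof (rule differentiable_bound[where f' = "\<lambda>t h. h *\<^sub>R f' t" and S = "closed_segment y x"])
    show "(f has_derivative (\<lambda>h. h *\<^sub>R f' t)) (at t within closed_segment y x)" for t
      using der[of t] by (auto simp: has_vector_derivative_def intro: has_derivative_at_withinI)
    show "onorm (\<lambda>h. h *\<^sub>R f' t) \<le> 3 * C / (1 + y\<^sup>2)" if "t \<in> closed_segment y x" for t
      using bound[OF that] by (simp add: onorm_scaleR_left[OF bounded_linear_ident] onorm_id)
  qed auto
  then show ?thesis by simp
qed

lemma norm_cis_minus_1_ge:
  assumes "0 \<le> x" "x \<le> 1"
  shows "norm (cis (2 * pi * x) - 1) \<ge> 2 * min x (1 - x)"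
proof -
  have sin_ge: "sin y \<ge> y / 2" if "0 \<le> y" "y \<le> pi / 2" for y :: real
  proof -
    have y2: "y\<^sup>2 \<le> 3"
    proof -
      have "y \<le> 1.6" using that pi_approx by simp
      then have "y\<^sup>2 \<le> 1.6\<^sup>2" using that by (intro power_mono) auto
      then show ?thesis by (simp add: power2_eq_square)
    qed
    have "\<bar>sin y - (\<Sum>m<3. sin_coeff m * y ^ m)\<bar> \<le> inverse (fact 3) * \<bar>y\<bar> ^ 3"
      by (rule Maclaurin_sin_bound)
    then have "\<bar>sin y - y\<bar> \<le> y * y\<^sup>2 / 6"
      using that by (simp add: eval_nat_numeral sin_coeff_def)
    moreover have "y * y\<^sup>2 \<le> y * 3" using that y2 by (intro mult_left_mono) auto
    ultimately show ?thesis by linarith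
  qed
  have eq: "norm (cis (2 * pi * x) - 1) = 2 * sin (pi * x)"
  proof -
    have "(norm (cis (2 * pi * x) - 1))\<^sup>2 = (cos (2 * pi * x) - 1)\<^sup>2 + (sin (2 * pi * x))\<^sup>2"
      by (simp add: cmod_power2)
    also have "\<dots> = 2 - 2 * cos (2 * (pi * x))"
      using sin_cos_squared_add[of "2 * pi * x"] by (simp add: power2_eq_square algebra_simps)
    also have "\<dots> = (2 * sin (pi * x))\<^sup>2"
      by (simp only: cos_double_sin) (simp add: power_mult_distrib)
    finally show ?thesis
      using assms by (subst (asm) power2_eq_iff_nonneg) (auto intro!: sin_ge_zero mult_left_le)
  qed
  show ?thesis
  proof (cases "x \<le> 1 / 2")
    case True
    have "pi * x / 2 \<le> sin (pi * x)" using assms True by (intro sin_ge) auto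
    moreover have "2 * x \<le> pi * x" using assms pi_gt3 by (intro mult_right_mono) auto
    ultimately show ?thesis unfolding eq by (simp add: min_def)
  next
    case False
    have "pi * (1 - x) / 2 \<le> sin (pi * (1 - x))" using assms False by (intro sin_ge) auto
    moreover have "sin (pi * (1 - x)) = sin (pi * x)" by (simp add: right_diff_distrib sin_diff)
    moreover have "2 * (1 - x) \<le> pi * (1 - x)" using assms pi_gt3 by (intro mult_right_mono) auto
    ultimately show ?thesis unfolding eq using False by (simp add: min_def)
  qed
qed


section \<open>Poisson summation\<close>

lemma integrable_weight:
  fixes f :: "real \<Rightarrow> 'a::{banach, second_countable_topology}"
  assumes "f \<in> borel_measurable lborel" "\<And>x. norm (f x) \<le> C / (1 + x\<^sup>2)"
  shows "integrable lborel f"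
proof (rule Bochner_Integration.integrable_bound)
  have "integrable lborel (\<lambda>x::real. 1 / (1 + x\<^sup>2))"
    using integrable_inverse_1_plus_square by (simp add: set_integrable_def inverse_eq_divide)
  then show "integrable lborel (\<lambda>x. C * (1 / (1 + x\<^sup>2)))" by (rule integrable_mult_right)
  have "0 \<le> C" using order_trans[OF norm_ge_zero assms(2)[of 0]] by simp
  then show "AE x in lborel. norm (f x) \<le> norm (C * (1 / (1 + x\<^sup>2)))"
    using assms(2) by (intro AE_I2) simp
qed fact

text \<open>The periodisation \<open>F x = \<Sum> f (x + k)\<close> is Lipschitz and the Fourier integrals of \<open>f\<close> are the Fourier coefficients of
\<open>F\<close>. Their sum at the origin converges by telescoping: \<open>G = (F - F 0) / (exp (2 * pi * \<i> * x) - 1)\<close> is bounded,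
because the Lipschitz bound compensates the zeros of the denominator, and the coefficients of \<open>F - F 0\<close> are
differences of consecutive coefficients of \<open>G\<close>. These tend to zero by the Bessel inequality.\<close>

theorem poisson_summation:
  fixes f :: "real \<Rightarrow> complex"
  assumes der: "\<And>x. (f has_vector_derivative f' x) (at x)"
    and bound: "\<And>x. norm (f x) \<le> C / (1 + x\<^sup>2)" "\<And>x. norm (f' x) \<le> C / (1 + x\<^sup>2)"
  shows "(\<lambda>N. \<Sum>m\<in>{- int N..int N}. LINT x|lborel. f x * cis (- (2 * pi * of_int m * x)))
    \<longlonglongrightarrow> (\<Sum>\<^sub>\<infinity>k. f (of_int k))"
proof -
  obtain M :: real where M: "M > 0"
    "\<And>(a :: real) (K :: int set). finite K \<Longrightarrow> (\<Sum>k\<in>K. 1 / (1 + (1 * of_int k - a)\<^sup>2)) \<le> M"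
    using lattice_sums_bounded[of 1, OF zero_less_one] by blast
  have C0: "0 \<le> C" using order_trans[OF norm_ge_zero bound(1)[of 0]] by simp
  have cont_f: "continuous_on UNIV f"
    using der by (meson continuous_at_imp_continuous_on has_vector_derivative_continuous)
  then have f_meas [measurable]: "f \<in> borel_measurable borel"
    by (rule borel_measurable_continuous_onI)
  define F where "F x = (\<Sum>\<^sub>\<infinity>k. f (x + of_int k))" for x
  have weight: "C' / (1 + (1 * of_int k - (- x))\<^sup>2) = C' / (1 + (x + of_int k)\<^sup>2)" for k x C'
    by (simp add: add.commute)
  have summ: "(\<lambda>k. f (x + of_int k)) summable_on UNIV" for x
    using lattice_abs_summable(2)[of 1 "\<lambda>k. f (x + of_int k)" C "- x", unfolded weight] bound(1) by simp
  have has_sum: "((\<lambda>k. f (x + of_int k)) has_sum F x) UNIV" for x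
    unfolding F_def using summ[of x] by (rule has_sum_infsum)
  have partial: "norm (\<Sum>k\<in>K. f (x + of_int k)) \<le> C * M" if "finite K" for K x
  proof -
    have "norm (\<Sum>k\<in>K. f (x + of_int k)) \<le> (\<Sum>k\<in>K. C * (1 / (1 + (1 * of_int k - (-x))\<^sup>2)))"
      using bound(1) by (intro sum_norm_le) (simp add: add.commute)
    also have "\<dots> = C * (\<Sum>k\<in>K. (1 / (1 + (1 * of_int k - (-x))\<^sup>2)))"
      by (simp only: sum_distrib_left)
    also have "\<dots> \<le> C * M" using M(2)[OF that, of "- x"] C0 by (intro mult_left_mono)
    finally show ?thesis .
  qed
  define L where "L = 3 * C * M"
  have L0: "0 \<le> L" using C0 M(1) by (simp add: L_def)
  have lip: "norm (F x - F y) \<le> L * \<bar>x - y\<bar>" if "\<bar>x - y\<bar> \<le> 1" for x y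
  proof -
    have "((\<lambda>k. f (x + of_int k) - f (y + of_int k)) has_sum (F x - F y)) UNIV"
      using has_sum_add[OF has_sum[of x] has_sum_uminusI[OF has_sum[of y]]] by simp
    moreover have "norm (\<Sum>k\<in>K. f (x + of_int k) - f (y + of_int k)) \<le> L * \<bar>x - y\<bar>" if "finite K" for K
    proof -
      have "norm (\<Sum>k\<in>K. f (x + of_int k) - f (y + of_int k))
         \<le> (\<Sum>k\<in>K. (3 * C * \<bar>x - y\<bar>) * (1 / (1 + (1 * of_int k - (-y))\<^sup>2)))"
        using lipschitz_with_weight[OF der bound(2), of "x + of_int k" "y + of_int k" for k] \<open>\<bar>x - y\<bar> \<le> 1\<close>
        by (intro sum_norm_le) (simp add: add.commute)
      also have "\<dots> = (3 * C * \<bar>x - y\<bar>) * (\<Sum>k\<in>K. (1 / (1 + (1 * of_int k - (-y))\<^sup>2)))"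
        by (simp only: sum_distrib_left)
      also have "\<dots> \<le> (3 * C * \<bar>x - y\<bar>) * M"
        using M(2)[OF that, of "- y"] C0 by (intro mult_left_mono) auto
      finally show ?thesis by (simp add: L_def mult_ac)
    qed
    ultimately show ?thesis
      using tendsto_upperbound[OF tendsto_norm, of "sum (\<lambda>k. f (x + of_int k) - f (y + of_int k))" "F x - F y"
          "finite_subsets_at_top UNIV" "L * \<bar>x - y\<bar>"]
      by (simp add: has_sum_def eventually_finite_subsets_at_top_weakI)
  qed
  have "isCont F x" for x
    unfolding continuous_at_eps_delta
  proof (intro allI impI)
    fix e :: real assume "e > 0"
    define d where "d = min 1 (e / (L + 1))"
    have "d > 0" using \<open>e > 0\<close> L0 by (simp add: d_def)
    moreover have "dist (F y) (F x) < e" if "dist y x < d" for y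
    proof -
      have "norm (F y - F x) \<le> L * \<bar>y - x\<bar>" using that by (intro lip) (simp add: d_def dist_real_def)
      also have "\<dots> \<le> L * (e / (L + 1))" using that L0 by (intro mult_left_mono) (auto simp: d_def dist_real_def)
      also have "\<dots> < e" using L0 \<open>e > 0\<close> by (simp add: field_simps)
      finally show ?thesis by (simp add: dist_norm)
    qed
    ultimately show "\<exists>d>0. \<forall>y. dist y x < d \<longrightarrow> dist (F y) (F x) < e" by blast
  qed
  then have F_meas [measurable]: "F \<in> borel_measurable borel"
    by (intro borel_measurable_continuous_onI continuous_at_imp_continuous_on) auto
  have F1: "F 1 = F 0"
    unfolding F_def using infsum_reindex_bij_witness[of UNIV "\<lambda>k. k - 1" "\<lambda>k. k + 1" UNIV "\<lambda>k. f (of_int k)" "\<lambda>k. f (1 + of_int k)"]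
    by (simp add: add.commute)
  have F_lim: "(\<lambda>N. \<Sum>k\<in>{- int N..<int N}. f (x + of_int k)) \<longlonglongrightarrow> F x" for x
    using has_sum[of x] filterlim_int_intervals(2) unfolding has_sum_def by (rule filterlim_compose)
  have F_bound: "norm (F x) \<le> C * M" for x
    by (rule tendsto_upperbound[OF tendsto_norm[OF F_lim[of x]]]) (auto intro!: always_eventually partial)
  define J where "J = {0..<1::real}"
  have [measurable]: "J \<in> sets borel" by (simp add: J_def)
  have J_int: "integrable lborel (\<lambda>x. D * indicat_real J x)" for D
    by (intro integrable_mult_right integrable_real_indicator) (auto simp: J_def)

  have f_int: "integrable lborel f"
    by (rule integrable_weight[OF _ bound(1)]) simp

  define b where "b m = (LINT x|lborel. f x * cis (- (2 * pi * of_int m * x)))" for m :: int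
  \<comment> \<open>unfolding: the integral over the line is cut into unit cells, all shifted into \<open>J\<close>\<close>
  have b_eq: "b m = (LINT x|lborel. indicat_real J x *\<^sub>R (F x * cis (- (2 * pi * of_int m * x))))" for m
  proof -
    define e where "e x = cis (- (2 * pi * of_int m * x))" for x
    have [measurable]: "e \<in> borel_measurable borel" unfolding e_def by measurable
    have e_norm: "norm (e x) = 1" for x by (simp add: e_def)
    have e_per: "e (x + of_int k) = e x" for x k
    proof -
      have "e (x + of_int k) = e x * cis (2 * pi * of_int (- m) * of_int k)"
        by (simp add: e_def cis_mult algebra_simps)
      then show ?thesis by (simp only: cis_int_period mult_1_right)
    qed
    have fe_int: "integrable lborel (\<lambda>x. f x * e x)"
      by (rule Bochner_Integration.integrable_bound[OF f_int]) (auto simp: norm_mult e_norm)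
    have ind: "indicat_real J (x - of_int k) = (if k = \<lfloor>x\<rfloor> then 1 else 0)" for x k
      by (auto simp: J_def indicator_def) linarith+
    have fk_int: "integrable lborel (\<lambda>x. indicat_real J (x - of_int k) *\<^sub>R (f x * e x))" for k
      by (rule Bochner_Integration.integrable_bound[OF fe_int]) (auto simp: ind)
    have cell: "(LINT x|lborel. indicat_real J (x - of_int k) *\<^sub>R (f x * e x))
       = (LINT x|lborel. indicat_real J x *\<^sub>R (f (x + of_int k) * e x))" for k
      by (subst lborel_integral_real_affine[where c = 1 and t = "of_int k"]) (auto simp: e_per add.commute[of "of_int k"])
    have cell_int: "integrable lborel (\<lambda>x. indicat_real J x *\<^sub>R (f (x + of_int k) * e x))" for k
      using lborel_integrable_real_affine[OF fk_int[of k], of 1 "of_int k"] by (simp add: e_per add.commute[of "of_int k"])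
    have fin: "(LINT x|lborel. (\<Sum>k\<in>{- int N..<int N}. indicat_real J (x - of_int k) *\<^sub>R (f x * e x)))
      = (LINT x|lborel. indicat_real J x *\<^sub>R ((\<Sum>k\<in>{- int N..<int N}. f (x + of_int k)) * e x))" for N
    proof -
      have "(LINT x|lborel. (\<Sum>k\<in>{- int N..<int N}. indicat_real J (x - of_int k) *\<^sub>R (f x * e x)))
        = (\<Sum>k\<in>{- int N..<int N}. LINT x|lborel. indicat_real J (x - of_int k) *\<^sub>R (f x * e x))"
        by (intro Bochner_Integration.integral_sum fk_int)
      also have "\<dots> = (LINT x|lborel. (\<Sum>k\<in>{- int N..<int N}. indicat_real J x *\<^sub>R (f (x + of_int k) * e x)))"
        unfolding cell by (intro Bochner_Integration.integral_sum[symmetric] cell_int)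
      finally show ?thesis by (simp add: scaleR_sum_right sum_distrib_right)
    qed
    have "(\<lambda>N. LINT x|lborel. (\<Sum>k\<in>{- int N..<int N}. indicat_real J (x - of_int k) *\<^sub>R (f x * e x)))
      \<longlonglongrightarrow> (LINT x|lborel. f x * e x)"
    proof (rule integral_dominated_convergence[where w = "\<lambda>x. norm (f x * e x)"])
      have eq: "(\<Sum>k\<in>{- int N..<int N}. indicat_real J (x - of_int k) *\<^sub>R (f x * e x))
         = (if \<lfloor>x\<rfloor> \<in> {- int N..<int N} then f x * e x else 0)" for x N
        unfolding ind by (simp add: if_distrib[of "\<lambda>c. c *\<^sub>R _"] cong: if_cong)
      show "AE x in lborel. norm (\<Sum>k\<in>{- int N..<int N}. indicat_real J (x - of_int k) *\<^sub>R (f x * e x)) \<le> norm (f x * e x)" for N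
        unfolding eq by auto
      show "AE x in lborel. (\<lambda>N. \<Sum>k\<in>{- int N..<int N}. indicat_real J (x - of_int k) *\<^sub>R (f x * e x)) \<longlonglongrightarrow> f x * e x"
      proof (intro AE_I2)
        fix x :: real
        have "eventually (\<lambda>N. (if \<lfloor>x\<rfloor> \<in> {- int N..<int N} then f x * e x else 0) = f x * e x) sequentially"
          using eventually_gt_at_top[of "nat \<bar>\<lfloor>x\<rfloor>\<bar>"] by eventually_elim auto
        then show "(\<lambda>N. \<Sum>k\<in>{- int N..<int N}. indicat_real J (x - of_int k) *\<^sub>R (f x * e x)) \<longlonglongrightarrow> f x * e x"
          unfolding eq by (rule tendsto_eventually)
      qed
      show "(\<lambda>x. \<Sum>k\<in>{- int N..<int N}. indicat_real J (x - of_int k) *\<^sub>R (f x * e x)) \<in> borel_measurable lborel" for N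
        by measurable
    qed (use fe_int in \<open>auto intro!: integrable_norm\<close>)
    moreover have "(\<lambda>N. LINT x|lborel. indicat_real J x *\<^sub>R ((\<Sum>k\<in>{- int N..<int N}. f (x + of_int k)) * e x))
      \<longlonglongrightarrow> (LINT x|lborel. indicat_real J x *\<^sub>R (F x * e x))"
    proof (rule integral_dominated_convergence[where w = "\<lambda>x. C * M * indicat_real J x"])
      show "AE x in lborel. (\<lambda>N. indicat_real J x *\<^sub>R ((\<Sum>k\<in>{- int N..<int N}. f (x + of_int k)) * e x))
          \<longlonglongrightarrow> indicat_real J x *\<^sub>R (F x * e x)"
        by (intro AE_I2 tendsto_intros F_lim)
      show "AE x in lborel. norm (indicat_real J x *\<^sub>R ((\<Sum>k\<in>{- int N..<int N}. f (x + of_int k)) * e x)) \<le> C * M * indicat_real J x" for N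
        using partial[of "{- int N..<int N}"] by (intro AE_I2) (auto simp: norm_mult e_norm split: split_indicator)
    qed (use J_int in auto)
    ultimately have "(LINT x|lborel. f x * e x) = (LINT x|lborel. indicat_real J x *\<^sub>R (F x * e x))"
      unfolding fin by (rule LIMSEQ_unique)
    then show ?thesis by (simp add: b_def e_def)
  qed

  define G where "G x = indicat_real J x *\<^sub>R ((F x - F 0) / (cis (2 * pi * x) - 1))" for x
  have [measurable]: "G \<in> borel_measurable borel" unfolding G_def by measurable
  have cis_ne: "cis (2 * pi * x) - 1 \<noteq> 0" if "0 < x" "x < 1" for x
    using norm_cis_minus_1_ge[of x] that by auto
  have G_bound: "norm (G x) \<le> L" for x
  proof (cases "0 < x \<and> x < 1")
    case True
    have 1: "norm (F x - F 0) \<le> L * x" using lip[of x 0] True by simp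
    have 2: "norm (F x - F 0) \<le> L * (1 - x)" using lip[of x 1] True by (simp add: F1)
    have "norm (F x - F 0) \<le> L * min x (1 - x)" using 1 2 by (simp add: min_def)
    also have "\<dots> \<le> L * norm (cis (2 * pi * x) - 1)"
    proof (rule mult_left_mono[OF _ L0])
      have "0 \<le> min x (1 - x)" using True by simp
      then have "min x (1 - x) \<le> 2 * min x (1 - x)" by simp
      also have "\<dots> \<le> norm (cis (2 * pi * x) - 1)"
        by (rule norm_cis_minus_1_ge) (use True in auto)
      finally show "min x (1 - x) \<le> norm (cis (2 * pi * x) - 1)" .
    qed
    finally have "norm (F x - F 0) / norm (cis (2 * pi * x) - 1) \<le> L"
      using cis_ne[of x] True by (simp add: pos_divide_le_eq)
    then show ?thesis using True by (simp add: G_def J_def norm_divide)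
  next
    case False
    then have "G x = 0" by (cases "x = 0") (auto simp: G_def J_def)
    then show ?thesis using L0 by simp
  qed
  have G_supp: "G x = 0" if "x \<notin> {0..0 + 1}" for x using that by (auto simp: G_def J_def)
  define c where "c m = (LINT x|lborel. G x * cis (- (2 * pi * of_int m * x)))" for m :: int
  have G_int: "integrable lborel (\<lambda>x. G x * cis (- (2 * pi * of_int m * x)))" for m :: int
  proof (rule Bochner_Integration.integrable_bound[OF J_int[of L]])
    have "norm (G x * cis t) \<le> norm (L * indicat_real J x)" for x t
    proof (cases "x \<in> J")
      case True
      have "norm (G x * cis t) = norm (G x)" by (simp only: norm_mult norm_cis mult_1_right)
      also have "\<dots> \<le> L" by (rule G_bound)
      finally show ?thesis using True L0 by simp
    qed (simp add: G_def)
    then show "AE x in lborel. norm (G x * cis (- (2 * pi * of_int m * x))) \<le> norm (L * indicat_real J x)"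
      by (intro AE_I2)
  qed measurable
  have "(\<lambda>m. (norm (c m))\<^sup>2) summable_on UNIV"
  proof (rule nonneg_bdd_above_summable_on)
    show "bdd_above (sum (\<lambda>m. (norm (c m))\<^sup>2) ` {F. F \<subseteq> UNIV \<and> finite F})"
      using bessel_inequality[of 1 G L 0, OF _ _ G_bound G_supp]
      by (intro bdd_aboveI2[where M = "LINT x|lborel. (norm (G x))\<^sup>2"]) (auto simp: c_def)
  qed auto
  then have c2: "(\<lambda>m. (norm (c m))\<^sup>2) summable_on X" for X
    by (rule summable_on_subset) simp
  have c_lim: "(\<lambda>N. c (h N)) \<longlonglongrightarrow> 0" if "inj h" for h :: "nat \<Rightarrow> int"
  proof -
    have "(\<lambda>N. (norm (c (h N)))\<^sup>2) summable_on UNIV"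
      using c2[of "range h"] summable_on_reindex[OF that, of "\<lambda>m. (norm (c m))\<^sup>2"] by (simp add: o_def)
    then have "summable (\<lambda>N. (norm (c (h N)))\<^sup>2)"
      by (subst (asm) summable_on_UNIV_nonneg_real_iff) auto
    then have "(\<lambda>N. (norm (c (h N)))\<^sup>2) \<longlonglongrightarrow> 0" by (rule summable_LIMSEQ_zero)
    then have "(\<lambda>N. sqrt ((norm (c (h N)))\<^sup>2)) \<longlonglongrightarrow> sqrt 0" by (intro tendsto_intros)
    then show ?thesis by (simp add: tendsto_norm_zero_iff)
  qed
  have one: "(LINT x|lborel. indicat_real J x *\<^sub>R cis (- (2 * pi * of_int m * x))) = (if m = 0 then 1 else 0)" for m
  proof -
    have "(LINT x|lborel. indicat_real J x *\<^sub>R cis (- (2 * pi * of_int m * x)))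
      = (LINT x|lborel. indicat_real {0..0+1} x *\<^sub>R cis (2 * pi * of_int (- m) * x / 1))"
    proof (rule integral_cong_AE)
      show "AE x in lborel. indicat_real J x *\<^sub>R cis (- (2 * pi * of_int m * x))
        = indicat_real {0..0+1} x *\<^sub>R cis (2 * pi * of_int (- m) * x / 1)"
        using AE_lborel_singleton[of "1::real"] by eventually_elim (auto simp: J_def split: split_indicator)
    qed measurable
    then show ?thesis
      using has_bochner_integral_character[of 1 0 "- m"] by (simp add: has_bochner_integral_iff)
  qed
  have tele: "b m = (if m = 0 then F 0 else 0) + (c (m - 1) - c m)" for m
  proof -
    have "indicat_real J x *\<^sub>R (F x * cis (- (2 * pi * of_int m * x)))
      = F 0 * (indicat_real J x *\<^sub>R cis (- (2 * pi * of_int m * x)))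
        + (G x * cis (- (2 * pi * of_int (m - 1) * x)) - G x * cis (- (2 * pi * of_int m * x)))" for x
    proof (cases "x \<in> J")
      case True
      have s: "cis (- (2 * pi * of_int (m - 1) * x)) = cis (2 * pi * x) * cis (- (2 * pi * of_int m * x))"
        by (simp add: cis_mult algebra_simps)
      have "G x * (cis (2 * pi * x) - 1) = F x - F 0"
        using True cis_ne[of x] by (cases "x = 0") (auto simp: G_def J_def)
      moreover have "G x * cis (- (2 * pi * of_int (m - 1) * x)) - G x * cis (- (2 * pi * of_int m * x))
         = (G x * (cis (2 * pi * x) - 1)) * cis (- (2 * pi * of_int m * x))"
        unfolding s by (simp only: left_diff_distrib right_diff_distrib mult.assoc mult_1_right mult_1_left)
      ultimately have "G x * cis (- (2 * pi * of_int (m - 1) * x)) - G x * cis (- (2 * pi * of_int m * x))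
         = (F x - F 0) * cis (- (2 * pi * of_int m * x))"
        by simp
      then show ?thesis using True by (simp add: algebra_simps)
    qed (simp add: G_def)
    then have "b m = (LINT x|lborel. F 0 * (indicat_real J x *\<^sub>R cis (- (2 * pi * of_int m * x)))
        + (G x * cis (- (2 * pi * of_int (m - 1) * x)) - G x * cis (- (2 * pi * of_int m * x))))"
      unfolding b_eq by (simp only:)
    also have "\<dots> = (LINT x|lborel. F 0 * (indicat_real J x *\<^sub>R cis (- (2 * pi * of_int m * x)))) + (c (m - 1) - c m)"
      unfolding c_def
    proof (subst Bochner_Integration.integral_add)
      have "integrable lborel (\<lambda>x. indicat_real J x *\<^sub>R cis (- (2 * pi * of_int m * x)))"
        by (rule Bochner_Integration.integrable_bound[OF J_int[of 1]]) auto
      then show "integrable lborel (\<lambda>x. F 0 * (indicat_real J x *\<^sub>R cis (- (2 * pi * of_int m * x))))"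
        by (rule integrable_mult_right)
    qed (intro Bochner_Integration.integrable_diff G_int
         | subst Bochner_Integration.integral_diff, rule G_int, rule G_int, rule refl)+
    also have "\<dots> = (if m = 0 then F 0 else 0) + (c (m - 1) - c m)"
      by (simp only: integral_mult_right_zero one) simp
    finally show ?thesis .
  qed
  have "(\<Sum>m\<in>{- int N..int N}. b m) = F 0 + (c (- int (Suc N)) - c (int N))" for N
  proof -
    have "(\<Sum>m\<in>{- int N..int N}. c (m - 1) - c m) = c (- int (Suc N)) - c (int N)"
    proof (induction N)
      case (Suc N)
      have "{- int (Suc N)..int (Suc N)} = insert (- int (Suc N)) (insert (int (Suc N)) {- int N..int N})" by auto
      then show ?case using Suc by (simp add: algebra_simps)
    qed (simp add: algebra_simps)
    then show ?thesis
      unfolding tele sum.distrib by (simp add: sum.delta)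
  qed
  moreover have "(\<lambda>N. F 0 + (c (- int (Suc N)) - c (int N))) \<longlonglongrightarrow> F 0 + (0 - 0)"
    by (intro tendsto_intros c_lim) (auto simp: inj_def)
  ultimately show ?thesis by (simp add: b_def F_def)
qed


section \<open>The Fourier transform of Hermite functions\<close>

lemma integral_derivative_eq_0:
  fixes F :: "real \<Rightarrow> complex"
  assumes der: "\<And>x. (F has_vector_derivative f x) (at x)" and cont: "\<And>x. isCont f x"
    and bound: "\<And>x. norm (F x) \<le> C / (1 + x\<^sup>2)" "\<And>x. norm (f x) \<le> D / (1 + x\<^sup>2)"
  shows "(LINT x|lborel. f x) = 0"
proof -
  have [measurable]: "f \<in> borel_measurable borel"
    using cont by (intro borel_measurable_continuous_onI continuous_at_imp_continuous_on) auto
  have int: "integrable lborel f" by (rule integrable_weight[OF _ bound(2)]) simp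
  have "((\<lambda>x::real. C / (1 + x\<^sup>2)) \<longlongrightarrow> 0) at_top" "((\<lambda>x::real. C / (1 + x\<^sup>2)) \<longlongrightarrow> 0) at_bot"
    by real_asymp+
  from this[THEN Lim_null_comparison[OF always_eventually[OF allI[OF bound(1)]]]]
  have lim: "(F \<longlongrightarrow> 0) at_top" "(F \<longlongrightarrow> 0) at_bot" .
  have "(LBINT x=-\<infinity>..\<infinity>. f x) = 0 - 0"
    by (rule interval_integral_FTC_integrable[where F = F])
      (use der cont int lim in \<open>auto simp: ereal_tendsto_simps set_integrable_def\<close>)
  then show ?thesis
    by (simp add: interval_lebesgue_integral_def set_lebesgue_integral_def)
qed

lemma herm_weight: "\<exists>C. \<forall>x. \<bar>herm n x\<bar> \<le> C / (1 + x\<^sup>2) ^ k"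
proof -
  obtain C where "\<forall>x. \<bar>herm n x\<bar> * (1 + x\<^sup>2) ^ k \<le> C" using herm_bound[of n k] by blast
  then have "\<bar>herm n x\<bar> \<le> C / (1 + x\<^sup>2) ^ k" for x
    by (subst pos_le_divide_eq) (auto intro!: zero_less_power add_pos_nonneg)
  then show ?thesis by blast
qed

text \<open>The derivative of \<open>herm n\<close> as a combination of neighbouring functions: with no factor \<open>x\<close> in it, both its decay and
the recursion for the Fourier transform can be read off.\<close>

definition herm' :: "nat \<Rightarrow> real \<Rightarrow> real" where
  "herm' n x = 2 * pi * real n * herm (n - 1) x - herm (Suc n) x / 2"

lemma herm_has_derivative: "(herm n has_real_derivative herm' n x) (at x)"
proof -
  have "2 * pi * x * herm n x - herm (Suc n) x = herm' n x"
    using herm_Suc[of n x] by (simp add: herm'_def field_simps)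
  then show ?thesis using DERIV_herm[of n x] by simp
qed

lemma herm'_weight: "\<exists>C. \<forall>x. \<bar>herm' n x\<bar> \<le> C / (1 + x\<^sup>2) ^ k"
proof -
  obtain C1 C2 where C: "\<And>x. \<bar>herm (n - 1) x\<bar> \<le> C1 / (1 + x\<^sup>2) ^ k" "\<And>x. \<bar>herm (Suc n) x\<bar> \<le> C2 / (1 + x\<^sup>2) ^ k"
    using herm_weight by metis
  have "\<bar>herm' n x\<bar> \<le> (2 * pi * real n * C1 + C2 / 2) / (1 + x\<^sup>2) ^ k" for x
  proof -
    have "\<bar>herm' n x\<bar> \<le> \<bar>2 * pi * real n * herm (n - 1) x\<bar> + \<bar>herm (Suc n) x / 2\<bar>"
      unfolding herm'_def by (rule abs_triangle_ineq4)
    also have "\<dots> = 2 * pi * real n * \<bar>herm (n - 1) x\<bar> + \<bar>herm (Suc n) x\<bar> / 2"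
      by (simp add: abs_mult)
    also have "\<dots> \<le> 2 * pi * real n * (C1 / (1 + x\<^sup>2) ^ k) + C2 / (1 + x\<^sup>2) ^ k / 2"
      using C by (intro add_mono mult_left_mono divide_right_mono) auto
    finally show ?thesis by (simp add: add_divide_distrib)
  qed
  then show ?thesis by blast
qed

definition herm_hat :: "nat \<Rightarrow> real \<Rightarrow> complex" where
  "herm_hat n \<xi> = (LINT x|lborel. complex_of_real (herm n x) * cis (- (2 * pi * \<xi> * x)))"

lemma integrable_herm_character:
  "integrable lborel (\<lambda>x. complex_of_real (herm n x) * cis (- (2 * pi * \<xi> * x)))"
proof -
  obtain C where C: "\<And>x. \<bar>herm n x\<bar> \<le> C / (1 + x\<^sup>2) ^ 1" using herm_weight by metis
  have [measurable]: "(\<lambda>x. complex_of_real (herm n x)) \<in> borel_measurable borel"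
    by (intro borel_measurable_continuous_onI continuous_intros)
  show ?thesis
    by (rule integrable_weight[where C = C]) (use C in \<open>auto simp: norm_mult\<close>)
qed

text \<open>Integration by parts replaces the transform of \<open>herm' n\<close> by \<open>2 * pi * \<i> * \<xi>\<close> times that of \<open>herm n\<close>. The result
is the three-term recursion of \<open>(- \<i>)\<^sup>n * herm n \<xi>\<close>.\<close>

lemma herm_hat_Suc:
  "herm_hat (Suc n) \<xi> = 4 * pi * real n * herm_hat (n - 1) \<xi> - 4 * pi * \<i> * \<xi> * herm_hat n \<xi>"
proof -
  define e where "e x = cis (- (2 * pi * \<xi> * x))" for x
  define f where "f x = complex_of_real (herm' n x) * e x - 2 * pi * \<i> * \<xi> * (complex_of_real (herm n x) * e x)" for x
  have e_der: "(e has_vector_derivative (- 2 * pi * \<i> * \<xi> * e x)) (at x)" for x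
    unfolding e_def[abs_def] has_vector_derivative_def
    by (rule derivative_eq_intros refl)+ (auto simp: scaleR_conv_of_real fun_eq_iff algebra_simps)
  obtain C where C: "\<And>x. \<bar>herm n x\<bar> \<le> C / (1 + x\<^sup>2) ^ 1" using herm_weight by metis
  obtain D where D: "\<And>x. \<bar>herm' n x\<bar> \<le> D / (1 + x\<^sup>2) ^ 1" using herm'_weight by metis
  have "(LINT x|lborel. f x) = 0"
  proof (rule integral_derivative_eq_0)
    show "((\<lambda>x. complex_of_real (herm n x) * e x) has_vector_derivative f x) (at x)" for x
    proof -
      have "((\<lambda>x. complex_of_real (herm n x)) has_vector_derivative complex_of_real (herm' n x)) (at x)"
        using herm_has_derivative[of n x] by (intro has_vector_derivative_of_real) (simp add: has_real_derivative_iff_has_vector_derivative)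
      from has_vector_derivative_mult[OF this e_der[of x]] show ?thesis
        by (simp add: f_def algebra_simps)
    qed
    have "continuous_on UNIV f"
      unfolding f_def herm'_def e_def by (intro continuous_intros continuous_on_herm) auto
    then show "isCont f x" for x by (simp add: continuous_on_eq_continuous_at)
    show "norm (complex_of_real (herm n x) * e x) \<le> C / (1 + x\<^sup>2)" for x
      using C[of x] by (simp add: norm_mult e_def)
    show "norm (f x) \<le> (D + 2 * pi * \<bar>\<xi>\<bar> * C) / (1 + x\<^sup>2)" for x
    proof -
      have "norm (f x) \<le> norm (complex_of_real (herm' n x) * e x) + norm (2 * pi * \<i> * \<xi> * (complex_of_real (herm n x) * e x))"
        unfolding f_def by (rule norm_triangle_ineq4)
      also have "\<dots> = \<bar>herm' n x\<bar> + 2 * pi * \<bar>\<xi>\<bar> * \<bar>herm n x\<bar>"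
        by (simp add: norm_mult e_def)
      also have "\<dots> \<le> D / (1 + x\<^sup>2) ^ 1 + 2 * pi * \<bar>\<xi>\<bar> * (C / (1 + x\<^sup>2) ^ 1)"
        using C D by (intro add_mono mult_left_mono) auto
      finally show ?thesis by (simp add: add_divide_distrib)
    qed
  qed
  moreover have "f x = (2 * pi * real n) * (complex_of_real (herm (n - 1) x) * e x)
      - (1 / 2) * (complex_of_real (herm (Suc n) x) * e x)
      - 2 * pi * \<i> * \<xi> * (complex_of_real (herm n x) * e x)" for x
    by (simp add: f_def herm'_def algebra_simps)
  then have "(LINT x|lborel. f x) = (2 * pi * real n) * herm_hat (n - 1) \<xi>
      - (1 / 2) * herm_hat (Suc n) \<xi> - 2 * pi * \<i> * \<xi> * herm_hat n \<xi>"
    using integrable_herm_character unfolding e_def herm_hat_def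
    by (simp only: Bochner_Integration.integral_diff integrable_mult_right Bochner_Integration.integrable_diff integral_mult_right_zero)
  ultimately have "(1 / 2) * herm_hat (Suc n) \<xi> = (2 * pi * real n) * herm_hat (n - 1) \<xi> - 2 * pi * \<i> * \<xi> * herm_hat n \<xi>"
    by (simp add: algebra_simps)
  then have "2 * ((1 / 2) * herm_hat (Suc n) \<xi>) = 2 * ((2 * pi * real n) * herm_hat (n - 1) \<xi> - 2 * pi * \<i> * \<xi> * herm_hat n \<xi>)"
    by simp
  then show ?thesis by (simp add: right_diff_distrib)
qed

text \<open>The characteristic function of the standard normal distribution, rescaled by \<open>sqrt (2 * pi)\<close>.\<close>

lemma herm_hat_0: "herm_hat 0 \<xi> = complex_of_real (herm 0 \<xi>)"
proof -
  define s where "s = sqrt (2 * pi)"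
  have s: "s > 0" "s\<^sup>2 = 2 * pi" by (auto simp: s_def)
  have "complex_of_real (exp (- ((- s * \<xi>)\<^sup>2) / 2)) = char std_normal_distribution (- s * \<xi>)"
    by (simp add: char_std_normal_distribution)
  also have "\<dots> = (LINT x|lborel. std_normal_density x *\<^sub>R cis (- s * \<xi> * x))"
    unfolding char_def by (subst integral_density) (auto simp: cis_conv_exp)
  also have "\<dots> = \<bar>s\<bar> *\<^sub>R (LINT x|lborel. std_normal_density (0 + s * x) *\<^sub>R cis (- s * \<xi> * (0 + s * x)))"
    using s by (intro lborel_integral_real_affine) auto
  also have "\<dots> = (LINT x|lborel. s *\<^sub>R (std_normal_density (0 + s * x) *\<^sub>R cis (- s * \<xi> * (0 + s * x))))"
    by (simp only: integral_scaleR_right abs_of_pos[OF s(1)])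
  also have "\<dots> = herm_hat 0 \<xi>"
    unfolding herm_hat_def
  proof (intro Bochner_Integration.integral_cong refl)
    fix x
    have "s * std_normal_density (0 + s * x) = herm 0 x"
      unfolding std_normal_density_def herm_def using s by (simp add: power_mult_distrib s_def)
    moreover have "- s * \<xi> * (0 + s * x) = - (2 * pi * \<xi> * x)"
      using s(2) by (simp add: power2_eq_square mult_ac)
    ultimately show "s *\<^sub>R (std_normal_density (0 + s * x) *\<^sub>R cis (- s * \<xi> * (0 + s * x))) = complex_of_real (herm 0 x) * cis (- (2 * pi * \<xi> * x))"
      by (metis scaleR_conv_of_real scaleR_scaleR)
  qed
  finally show ?thesis using s(2) by (simp add: herm_def power_mult_distrib)
qed

theorem herm_hat_eq: "herm_hat n \<xi> = (- \<i>) ^ n * complex_of_real (herm n \<xi>)"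
proof (induction n rule: induct_nat_012)
  case 0
  then show ?case by (simp add: herm_hat_0)
next
  case 1
  have "herm 1 \<xi> = 4 * pi * \<xi> * herm 0 \<xi>" by (simp add: herm_def)
  then show ?case using herm_hat_Suc[of 0 \<xi>] by (simp add: herm_hat_0 algebra_simps)
next
  case (ge2 n)
  have "herm_hat (Suc (Suc n)) \<xi> = 4 * pi * real (Suc n) * ((- \<i>) ^ n * complex_of_real (herm n \<xi>))
     - 4 * pi * \<i> * \<xi> * ((- \<i>) ^ Suc n * complex_of_real (herm (Suc n) \<xi>))"
    using herm_hat_Suc[of "Suc n" \<xi>] ge2 by simp
  also have "\<dots> = (- \<i>) ^ Suc (Suc n) * complex_of_real (4 * pi * \<xi> * herm (Suc n) \<xi> - 4 * pi * real (Suc n) * herm n \<xi>)"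
    by (simp add: algebra_simps)
  also have "4 * pi * \<xi> * herm (Suc n) \<xi> - 4 * pi * real (Suc n) * herm n \<xi> = herm (Suc (Suc n)) \<xi>"
    using herm_Suc[of "Suc n" \<xi>] by simp
  finally show ?case .
qed


section \<open>The functional equation of the alternating sums\<close>

definition herm_sum :: "nat \<Rightarrow> real \<Rightarrow> real \<Rightarrow> real" where
  "herm_sum n lam y = (\<Sum>\<^sub>\<infinity>k::int. (-1) powi k * herm n (lam * (of_int k + y)))"

lemma affine_weight:
  fixes g :: "real \<Rightarrow> 'a::real_normed_vector"
  assumes "lam > 0" "\<And>t. norm (g t) \<le> C / (1 + t\<^sup>2)"
  shows "norm (g (lam * (x + y))) \<le> C * (1 + 2 * y\<^sup>2 + 2 / lam\<^sup>2) / (1 + x\<^sup>2)"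
proof -
  have C: "0 \<le> C" using order_trans[OF norm_ge_zero assms(2)[of 0]] by simp
  define A where "A = 1 + 2 * y\<^sup>2 + 2 / lam\<^sup>2"
  have A: "A > 0" using assms(1) by (simp add: A_def add_pos_nonneg)
  have "x\<^sup>2 \<le> 2 * y\<^sup>2 + 2 * (x + y)\<^sup>2"
    using zero_le_power2[of "x + 2 * y"] by (simp add: power2_eq_square algebra_simps)
  moreover have "A * (1 + w\<^sup>2) = 1 + 2 * y\<^sup>2 + 2 / lam\<^sup>2 + 2 * (w\<^sup>2 / lam\<^sup>2) + (1 + 2 * y\<^sup>2) * w\<^sup>2" for w
    by (simp add: A_def algebra_simps add_divide_distrib)
  from this[of "lam * (x + y)"]
  have "A * (1 + (lam * (x + y))\<^sup>2) = 1 + 2 * y\<^sup>2 + 2 / lam\<^sup>2 + 2 * (x + y)\<^sup>2 + (1 + 2 * y\<^sup>2) * (lam * (x + y))\<^sup>2"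
    using assms(1) by (simp add: power_mult_distrib)
  moreover have "0 \<le> (1 + 2 * y\<^sup>2) * (lam * (x + y))\<^sup>2" "0 \<le> 2 / lam\<^sup>2" by auto
  ultimately have "1 + x\<^sup>2 \<le> A * (1 + (lam * (x + y))\<^sup>2)" by linarith
  then have "C * A / (A * (1 + (lam * (x + y))\<^sup>2)) \<le> C * A / (1 + x\<^sup>2)"
    using C A by (intro divide_left_mono) (auto intro!: mult_pos_pos add_pos_nonneg mult_nonneg_nonneg)
  moreover have "C * A / (A * (1 + (lam * (x + y))\<^sup>2)) = C / (1 + (lam * (x + y))\<^sup>2)"
    using A by simp
  ultimately show ?thesis using assms(2)[of "lam * (x + y)"] by (simp add: A_def)
qed

lemma herm_lattice_summable:
  assumes "lam > 0"
  shows "(\<lambda>k::int. norm (herm n (lam * (of_int k + y)))) summable_on UNIV"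
proof -
  obtain C where C: "\<And>x. \<bar>herm n x\<bar> \<le> C / (1 + x\<^sup>2) ^ 1" using herm_weight by metis
  show ?thesis
    by (rule lattice_abs_summable(1)[OF assms, where C = C and a = "- lam * y"])
      (use C in \<open>simp add: distrib_left\<close>)
qed

lemma herm_sum_summable:
  assumes "lam > 0"
  shows "(\<lambda>k::int. (-1) powi k * herm n (lam * (of_int k + y))) summable_on UNIV"
proof (rule abs_summable_summable)
  show "(\<lambda>k::int. norm ((-1) powi k * herm n (lam * (of_int k + y)))) summable_on UNIV"
    using herm_lattice_summable[OF assms, of n y] by (simp add: abs_mult)
qed

lemma herm_sum_minus:
  assumes "even n"
  shows "herm_sum n lam (- y) = herm_sum n lam y"
  unfolding herm_sum_def
proof (rule infsum_reindex_bij_witness[of _ uminus uminus])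
  fix k :: int
  have "lam * (of_int (- k) + y) = - (lam * (of_int k + - y))" by (simp add: algebra_simps)
  then have "herm n (lam * (of_int (- k) + y)) = herm n (lam * (of_int k + - y))"
    using assms by (simp only: herm_minus) simp
  then show "(- 1) powi (- k) * herm n (lam * (of_int (- k) + y)) = (- 1) powi k * herm n (lam * (of_int k + - y))"
    by (simp only: power_int_minus_one_minus)
qed auto

lemma herm_sum_plus_1: "herm_sum n lam (y + 1) = - herm_sum n lam y"
proof -
  have "herm_sum n lam (y + 1) = (\<Sum>\<^sub>\<infinity>k::int. (- 1) * ((-1) powi k * herm n (lam * (of_int k + y))))"
    unfolding herm_sum_def
    by (rule infsum_reindex_bij_witness[of _ "\<lambda>k. k - 1" "\<lambda>k. k + 1"])
      (auto simp: power_int_add algebra_simps)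
  then show ?thesis by (simp only: infsum_cmult_right') (simp add: herm_sum_def)
qed

lemma infsum_int_mod_3:
  fixes h :: "int \<Rightarrow> 'a::banach"
  assumes "h summable_on UNIV"
  shows "infsum h UNIV = (\<Sum>\<^sub>\<infinity>j. h (3 * j)) + (\<Sum>\<^sub>\<infinity>j. h (3 * j + 1)) + (\<Sum>\<^sub>\<infinity>j. h (3 * j + 2))"
proof -
  define R where "R r = range (\<lambda>j::int. 3 * j + r)" for r
  have R: "infsum h (R r) = (\<Sum>\<^sub>\<infinity>j. h (3 * j + r))" for r
    unfolding R_def by (subst infsum_reindex) (auto simp: inj_on_def o_def)
  have mem: "x \<in> R r \<longleftrightarrow> x mod 3 = r mod 3" for x r
  proof
    assume "x mod 3 = r mod 3"
    then have "x = 3 * ((x - r) div 3) + r"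
      by (metis add.commute diff_add_cancel dvd_mult_div_cancel mod_eq_dvd_iff)
    then show "x \<in> R r" unfolding R_def by blast
  qed (auto simp: R_def)
  have s: "h summable_on A" for A using summable_on_subset_banach[OF assms, of A] by simp
  have U: "UNIV = (R 0 \<union> R 1) \<union> R 2"
  proof (intro set_eqI iffI UNIV_I)
    fix x :: int
    have "x mod 3 = 0 \<or> x mod 3 = 1 \<or> x mod 3 = 2" by presburger
    then show "x \<in> (R 0 \<union> R 1) \<union> R 2" by (auto simp: mem)
  qed
  have "infsum h UNIV = infsum h (R 0) + infsum h (R 1) + infsum h (R 2)"
    unfolding U by (subst infsum_Un_disjoint; (subst infsum_Un_disjoint)?) (use s in \<open>auto simp: mem\<close>)
  then show ?thesis by (simp add: R)
qed

lemma infsum_of_real_complex: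
  assumes "f summable_on A"
  shows "(\<Sum>\<^sub>\<infinity>x\<in>A. complex_of_real (f x)) = complex_of_real (\<Sum>\<^sub>\<infinity>x\<in>A. f x)"
  by (rule infsumI) (simp add: has_sum_of_real_iff has_sum_infsum[OF assms])

text \<open>Poisson summation is applied to \<open>herm n (\<lambda> * (x + 1/6)) * exp (pi * \<i> * x)\<close>, whose values at the integers carry
the alternating signs. The dual sum runs over the half-integers \<open>m - 1/2\<close>, scaled by \<open>1/\<lambda>\<close> and weighted by sixth
roots of \<open>-1\<close>. Along each residue class of \<open>m\<close> modulo \<open>3\<close> the weights alternate, which gives the sums
\<open>herm_sum n (3/\<lambda>) y\<close> for \<open>y = - 1/6\<close>, \<open>1/6\<close>, \<open>1/2\<close>; the first two agree, the third is zero by symmetry,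
and \<open>sqrt 3 = 2 * cos (pi/6)\<close> is what remains of the weights.\<close>

theorem herm_sum_functional_equation:
  assumes lam: "lam > 0" and "even n"
  shows "herm_sum n lam (1 / 6) = (- 1) ^ (n div 2) * sqrt 3 / lam * herm_sum n (3 / lam) (1 / 6)"
proof -
  define f where "f x = complex_of_real (herm n (lam * (x + 1 / 6))) * cis (pi * x)" for x
  define f' where "f' x = complex_of_real (herm n (lam * (x + 1 / 6))) * (pi * \<i> * cis (pi * x))
    + complex_of_real (herm' n (lam * (x + 1 / 6)) * lam) * cis (pi * x)" for x
  obtain C where C: "\<And>x. norm (herm n x) \<le> C / (1 + x\<^sup>2)" using herm_weight[of n 1] by auto
  obtain D where D: "\<And>x. norm (herm' n x) \<le> D / (1 + x\<^sup>2)" using herm'_weight[of n 1] by auto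
  define A where "A = 1 + 2 * (1 / 6)\<^sup>2 + 2 / lam\<^sup>2"
  note CA = affine_weight[OF lam C, of _ "1 / 6", folded A_def]
  note DA = affine_weight[OF lam D, of _ "1 / 6", folded A_def]
  define B where "B = C * A * pi + D * A * lam"
  have nonneg: "0 \<le> C * A" "0 \<le> D * A"
    using order_trans[OF norm_ge_zero CA[of 0]] order_trans[OF norm_ge_zero DA[of 0]] by auto
  have "(\<lambda>N. \<Sum>m\<in>{- int N..int N}. LINT x|lborel. f x * cis (- (2 * pi * of_int m * x)))
    \<longlonglongrightarrow> (\<Sum>\<^sub>\<infinity>k. f (of_int k))"
  proof (rule poisson_summation)
    show "(f has_vector_derivative f' x) (at x)" for x
    proof -
      have "((\<lambda>x. herm n (lam * (x + 1 / 6))) has_real_derivative herm' n (lam * (x + 1 / 6)) * lam) (at x)"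
        by (rule DERIV_chain2[OF herm_has_derivative]) (auto intro!: derivative_eq_intros)
      then have 1: "((\<lambda>x. complex_of_real (herm n (lam * (x + 1 / 6)))) has_vector_derivative
          complex_of_real (herm' n (lam * (x + 1 / 6)) * lam)) (at x)"
        by (intro has_vector_derivative_of_real) (simp add: has_real_derivative_iff_has_vector_derivative)
      have 2: "((\<lambda>x. cis (pi * x)) has_vector_derivative (pi * \<i> * cis (pi * x))) (at x)"
        unfolding has_vector_derivative_def
        by (rule derivative_eq_intros refl)+ (auto simp: scaleR_conv_of_real fun_eq_iff algebra_simps)
      show ?thesis
        unfolding f_def f'_def using has_vector_derivative_mult[OF 1 2] by simp
    qed
    show "norm (f x) \<le> B / (1 + x\<^sup>2)" for x
    proof -
      have "norm (f x) = norm (herm n (lam * (x + 1 / 6)))" by (simp add: f_def norm_mult)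
      also have "\<dots> \<le> C * A / (1 + x\<^sup>2)" by (rule CA)
      also have "\<dots> \<le> B / (1 + x\<^sup>2)"
      proof (rule divide_right_mono)
        have "C * A * 1 \<le> C * A * pi" using nonneg pi_gt3 by (intro mult_left_mono) auto
        moreover have "0 \<le> D * A * lam" using nonneg lam by simp
        ultimately show "C * A \<le> B" by (simp add: B_def)
      qed simp
      finally show ?thesis .
    qed
    show "norm (f' x) \<le> B / (1 + x\<^sup>2)" for x
    proof -
      have "norm (f' x) \<le> norm (herm n (lam * (x + 1 / 6))) * pi + norm (herm' n (lam * (x + 1 / 6))) * lam"
        unfolding f'_def by (rule order_trans[OF norm_triangle_ineq]) (use lam in \<open>simp add: norm_mult\<close>)
      also have "\<dots> \<le> C * A / (1 + x\<^sup>2) * pi + D * A / (1 + x\<^sup>2) * lam"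
        using CA DA lam by (intro add_mono mult_right_mono) auto
      also have "\<dots> = B / (1 + x\<^sup>2)" by (simp add: B_def add_divide_distrib)
      finally show ?thesis .
    qed
  qed
  moreover have "(\<Sum>\<^sub>\<infinity>k. f (of_int k)) = complex_of_real (herm_sum n lam (1 / 6))"
  proof -
    have "f (of_int k) = complex_of_real ((-1) powi k * herm n (lam * (of_int k + 1 / 6)))" for k
    proof -
      have "cis (pi * of_int k) = (- 1) powi k"
        using cis_power_int[of pi k] by (simp add: mult.commute)
      then show ?thesis by (simp add: f_def mult.commute)
    qed
    then show ?thesis unfolding herm_sum_def by (simp only: infsum_of_real_complex[OF herm_sum_summable[OF lam]])
  qed
  moreover define g where "g m = cis (pi * (2 * of_int m - 1) / 6) * complex_of_real (herm n (3 / lam * ((2 * of_int m - 1) / 6)))" for m :: int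
  have "(LINT x|lborel. f x * cis (- (2 * pi * of_int m * x))) = (- \<i>) ^ n / lam * g m" for m
  proof -
    define \<xi> where "\<xi> = (2 * of_int m - 1) / (2 * lam)"
    have "herm_hat n \<xi> = \<bar>lam\<bar> *\<^sub>R (LINT x|lborel. complex_of_real (herm n (lam / 6 + lam * x)) * cis (- (2 * pi * \<xi> * (lam / 6 + lam * x))))"
      unfolding herm_hat_def using lam by (intro lborel_integral_real_affine) auto
    also have "(\<lambda>x. complex_of_real (herm n (lam / 6 + lam * x)) * cis (- (2 * pi * \<xi> * (lam / 6 + lam * x))))
      = (\<lambda>x. cis (- (pi * (2 * of_int m - 1) / 6)) * (f x * cis (- (2 * pi * of_int m * x))))"
    proof
      fix x
      have "- (2 * pi * \<xi> * (lam / 6 + lam * x)) = - (pi * (2 * of_int m - 1) / 6) + (pi * x + - (2 * pi * of_int m * x))"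
        using lam by (simp add: \<xi>_def field_simps)
      then have "cis (- (2 * pi * \<xi> * (lam / 6 + lam * x)))
         = cis (- (pi * (2 * of_int m - 1) / 6)) * (cis (pi * x) * cis (- (2 * pi * of_int m * x)))"
        by (simp only: cis_mult)
      moreover have "lam / 6 + lam * x = lam * (x + 1 / 6)" by (simp add: distrib_left)
      ultimately show "complex_of_real (herm n (lam / 6 + lam * x)) * cis (- (2 * pi * \<xi> * (lam / 6 + lam * x)))
         = cis (- (pi * (2 * of_int m - 1) / 6)) * (f x * cis (- (2 * pi * of_int m * x)))"
        by (simp add: f_def)
    qed
    finally have 1: "herm_hat n \<xi> = lam * (cis (- (pi * (2 * of_int m - 1) / 6)) * (LINT x|lborel. f x * cis (- (2 * pi * of_int m * x))))"
      using lam by (simp add: scaleR_conv_of_real)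
    have "g m = cis (pi * (2 * of_int m - 1) / 6) * complex_of_real (herm n \<xi>)"
    proof -
      have "3 / lam * ((2 * of_int m - 1) / 6) = \<xi>" using lam by (simp add: \<xi>_def field_simps)
      then show ?thesis by (simp only: g_def)
    qed
    then have "(- \<i>) ^ n * g m = cis (pi * (2 * of_int m - 1) / 6) * herm_hat n \<xi>"
      by (simp add: herm_hat_eq)
    also have "\<dots> = (cis (pi * (2 * of_int m - 1) / 6) * cis (- (pi * (2 * of_int m - 1) / 6))) * (lam * (LINT x|lborel. f x * cis (- (2 * pi * of_int m * x))))"
      unfolding 1 by (simp only: mult_ac)
    also have "\<dots> = lam * (LINT x|lborel. f x * cis (- (2 * pi * of_int m * x)))"
      by (simp add: cis_mult)
    finally show ?thesis using lam by (simp add: field_simps)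
  qed
  moreover have g_summable: "g summable_on UNIV"
  proof (rule abs_summable_summable)
    have "norm (g m) = norm (herm n (3 / lam * (1 / 3) * (of_int m + (- 1 / 2))))" for m
    proof -
      have "3 / lam * ((2 * of_int m - 1) / 6) = 3 / lam * (1 / 3) * (of_int m + (- 1 / 2))"
        using lam by (simp add: field_simps)
      then show ?thesis by (simp only: g_def norm_mult norm_cis norm_of_real mult_1_left real_norm_def)
    qed
    then show "(\<lambda>m. norm (g m)) summable_on UNIV"
      using herm_lattice_summable[of "3 / lam * (1 / 3)" n "- 1 / 2"] lam by simp
  qed
  then have "(\<lambda>N. \<Sum>m\<in>{- int N..int N}. (- \<i>) ^ n / lam * g m) \<longlonglongrightarrow> (- \<i>) ^ n / lam * infsum g UNIV"
    unfolding sum_distrib_left[symmetric]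
    using has_sum_infsum[OF g_summable] filterlim_int_intervals(1) unfolding has_sum_def
    by (intro tendsto_intros) (rule filterlim_compose)
  ultimately have main: "complex_of_real (herm_sum n lam (1 / 6)) = (- \<i>) ^ n / lam * infsum g UNIV"
    by (intro LIMSEQ_unique[of "\<lambda>N. \<Sum>m\<in>{- int N..int N}. (- \<i>) ^ n / lam * g m"]) (simp_all only:)
  have cell: "(\<Sum>\<^sub>\<infinity>j. g (3 * j + r)) = cis (pi * t) * complex_of_real (herm_sum n (3 / lam) t)"
    if t: "t = (2 * of_int r - 1) / 6" for r :: int and t :: real
  proof -
    have "g (3 * j + r) = cis (pi * t) * complex_of_real ((-1) powi j * herm n (3 / lam * (of_int j + t)))" for j
    proof -
      have "(2 * of_int (3 * j + r) - 1) / 6 = of_int j + t" by (simp add: t field_simps)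
      then have "g (3 * j + r) = cis (pi * (of_int j + t)) * complex_of_real (herm n (3 / lam * (of_int j + t)))"
        by (simp only: g_def flip: times_divide_eq_right)
      moreover have "cis (pi * (of_int j + t)) = (-1) powi j * cis (pi * t)"
        using cis_power_int[of pi j] by (simp add: distrib_left mult.commute flip: cis_mult)
      ultimately show ?thesis by simp
    qed
    moreover have "3 / lam > 0" using lam by simp
    ultimately show ?thesis
      by (simp only: infsum_cmult_right' infsum_of_real_complex[OF herm_sum_summable] herm_sum_def)
  qed
  \<comment> \<open>\<open>1/2\<close> and \<open>- 1/2\<close> are exchanged by the even symmetry and by the sign-changing shift by 1\<close>
  have half: "herm_sum n (3 / lam) (1 / 2) = 0"
    using herm_sum_plus_1[of n "3 / lam" "- (1 / 2)"] herm_sum_minus[OF \<open>even n\<close>, of "3 / lam" "1 / 2"] by simp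
  have "infsum g UNIV = (cis (- pi / 6) + cis (pi / 6)) * complex_of_real (herm_sum n (3 / lam) (1 / 6))"
    using infsum_int_mod_3[OF g_summable] cell[of "- 1 / 6" 0] cell[of "1 / 6" 1] cell[of "1 / 2" 2]
      herm_sum_minus[OF \<open>even n\<close>, of "3 / lam" "1 / 6"] half
    by (simp add: distrib_right)
  also have "cis (- pi / 6) + cis (pi / 6) = complex_of_real (sqrt 3)"
    by (simp add: complex_eq_iff cos_30 sin_30)
  finally have "infsum g UNIV = complex_of_real (sqrt 3 * herm_sum n (3 / lam) (1 / 6))" by simp
  moreover have "(- \<i>) ^ n = complex_of_real ((- 1) ^ (n div 2))"
  proof -
    from \<open>even n\<close> have "(- \<i>) ^ n = ((- \<i>)\<^sup>2) ^ (n div 2)" by (simp flip: power_mult)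
    then show ?thesis by simp
  qed
  ultimately have "complex_of_real (herm_sum n lam (1 / 6))
     = complex_of_real ((- 1) ^ (n div 2) * sqrt 3 / lam * herm_sum n (3 / lam) (1 / 6))"
    unfolding main by (simp add: mult_ac)
  then show ?thesis by (simp only: of_real_eq_iff)
qed


section \<open>A zero of the alternating sum\<close>

lemma herm_tendsto_0: "(herm n \<longlongrightarrow> 0) at_top"
proof -
  obtain C where C: "\<And>x. norm (herm n x) \<le> C / (1 + x\<^sup>2)" using herm_weight[of n 1] by auto
  have "((\<lambda>x::real. C / (1 + x\<^sup>2)) \<longlongrightarrow> 0) at_top" by real_asymp
  then show ?thesis by (rule Lim_null_comparison[OF always_eventually[OF allI[OF C]]])
qed

text \<open>Pairing \<open>k\<close> with \<open>- k\<close> turns the sum into \<open>herm n x\<close> minus an alternating series with positive decreasing terms.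
The point \<open>x\<close> itself may lie among the oscillations; only \<open>5 * x\<close> has to be past them.\<close>

lemma herm_sum_bounds:
  assumes "even n" and x: "x > 0" and far: "4 * real n \<le> 3 * pi * (5 * x)\<^sup>2"
  shows "herm_sum n (6 * x) (1 / 6) \<le> herm n x"
    and "herm n x - (herm n (5 * x) + herm n (7 * x)) \<le> herm_sum n (6 * x) (1 / 6)"
proof -
  define s where "s k = (-1) powi k * herm n (6 * x * (of_int k + 1 / 6))" for k :: int
  define b where "b i = herm n ((6 * real i + 5) * x) + herm n ((6 * real i + 7) * x)" for i :: nat
  have partial: "(\<Sum>k\<in>{- int N..int N}. s k) = herm n x - (\<Sum>i<N. (-1) ^ i * b i)" for N
  proof (induction N)
    case 0
    then show ?case by (simp add: s_def)
  next
    case (Suc N)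
    have set: "{- int (Suc N)..int (Suc N)} = insert (- int (Suc N)) (insert (int (Suc N)) {- int N..int N})" by auto
    have pw: "(-1) powi (int (Suc N)) = (- ((-1) ^ N) :: real)" by (simp only: power_int_of_nat power_Suc mult_minus1)
    have "6 * x * (of_int (int (Suc N)) + 1 / 6) = (6 * real N + 7) * x" by (simp add: algebra_simps)
    then have 1: "s (int (Suc N)) = - ((-1) ^ N) * herm n ((6 * real N + 7) * x)"
      by (simp only: s_def pw)
    have "6 * x * (of_int (- int (Suc N)) + 1 / 6) = - ((6 * real N + 5) * x)" by (simp add: algebra_simps)
    then have 2: "s (- int (Suc N)) = - ((-1) ^ N) * herm n ((6 * real N + 5) * x)"
      using \<open>even n\<close> by (simp only: s_def pw power_int_minus_one_minus herm_minus) simp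
    have "(\<Sum>k\<in>{- int (Suc N)..int (Suc N)}. s k) = s (- int (Suc N)) + (s (int (Suc N)) + (\<Sum>k\<in>{- int N..int N}. s k))"
      unfolding set by (subst sum.insert; (subst sum.insert)?) auto
    then show ?case unfolding Suc 1 2 by (simp add: b_def algebra_simps)
  qed
  have "(s has_sum herm_sum n (6 * x) (1 / 6)) UNIV"
    unfolding s_def herm_sum_def using x by (intro has_sum_infsum herm_sum_summable) simp
  then have "(\<lambda>N. \<Sum>k\<in>{- int N..int N}. s k) \<longlonglongrightarrow> herm_sum n (6 * x) (1 / 6)"
    using filterlim_int_intervals(1) unfolding has_sum_def by (rule filterlim_compose)
  then have lim: "(\<lambda>N. herm n x - (\<Sum>i<N. (-1) ^ i * b i)) \<longlonglongrightarrow> herm_sum n (6 * x) (1 / 6)"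
    unfolding partial .
  have beyond: "4 * real n \<le> 3 * pi * (c * x)\<^sup>2" "c * x > 0" if "c \<ge> 5" for c
    using beyond_threshold[OF _ _ far, of "c * x"] x that by auto
  have b_lim: "b \<longlonglongrightarrow> 0"
  proof -
    have "filterlim (\<lambda>i. (6 * real i + 5) * x) at_top sequentially" "filterlim (\<lambda>i. (6 * real i + 7) * x) at_top sequentially"
      using x by real_asymp+
    then have "b \<longlonglongrightarrow> 0 + 0"
      unfolding b_def by (intro tendsto_add filterlim_compose[OF herm_tendsto_0])
    then show ?thesis by simp
  qed
  have b_pos: "0 \<le> b i" for i
    unfolding b_def by (intro add_nonneg_nonneg less_imp_le[OF herm_pos] beyond) auto
  have b_mono: "b (Suc i) \<le> b i" for i
    unfolding b_def using x by (intro add_mono herm_antimono beyond) auto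
  note leibniz = summable_Leibniz'[OF b_lim b_pos b_mono]
  have "(\<lambda>N. herm n x - (\<Sum>i<N. (-1) ^ i * b i)) \<longlonglongrightarrow> herm n x - (\<Sum>i. (-1) ^ i * b i)"
    by (intro tendsto_intros summable_LIMSEQ leibniz(1))
  with lim have eq: "herm_sum n (6 * x) (1 / 6) = herm n x - (\<Sum>i. (-1) ^ i * b i)"
    by (rule LIMSEQ_unique)
  show "herm_sum n (6 * x) (1 / 6) \<le> herm n x" using leibniz(2)[of 0] by (simp add: eq)
  show "herm n x - (herm n (5 * x) + herm n (7 * x)) \<le> herm_sum n (6 * x) (1 / 6)"
    using leibniz(4)[of 0] by (simp add: eq b_def)
qed

lemma continuous_on_herm_sum:
  assumes "a > 0"
  shows "continuous_on {a..b} (\<lambda>lam. herm_sum n lam y)"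
proof -
  obtain C where C: "\<And>x. norm (herm n x) \<le> C / (1 + x\<^sup>2)" using herm_weight[of n 1] by auto
  have C0: "0 \<le> C" using order_trans[OF norm_ge_zero C[of 0]] by simp
  have "uniform_limit {a..b} (\<lambda>X lam. \<Sum>k\<in>X. (-1) powi k * herm n (lam * (of_int k + y)))
      (\<lambda>lam. \<Sum>\<^sub>\<infinity>k::int. (-1) powi k * herm n (lam * (of_int k + y))) (finite_subsets_at_top UNIV)"
  proof (rule Weierstrass_m_test_general)
    show "(\<lambda>k::int. C * (1 / (1 + (a * of_int k - (- a * y))\<^sup>2))) summable_on UNIV"
      by (intro summable_on_cmult_right lattice_summable assms)
    fix k :: int and lam assume lam: "lam \<in> {a..b}"
    have "a\<^sup>2 * (of_int k + y)\<^sup>2 \<le> lam\<^sup>2 * (of_int k + y)\<^sup>2"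
      using lam assms by (intro mult_right_mono power_mono) auto
    then have "(a * of_int k - (- a * y))\<^sup>2 \<le> (lam * (of_int k + y))\<^sup>2"
      by (simp add: power_mult_distrib flip: distrib_left)
    then have "C / (1 + (lam * (of_int k + y))\<^sup>2) \<le> C / (1 + (a * of_int k - (- a * y))\<^sup>2)"
      using C0 by (intro divide_left_mono) (auto intro!: mult_pos_pos add_pos_nonneg)
    then show "norm ((-1) powi k * herm n (lam * (of_int k + y))) \<le> C * (1 / (1 + (a * of_int k - (- a * y))\<^sup>2))"
      using C[of "lam * (of_int k + y)"] by (simp add: abs_mult)
  qed
  then show ?thesis
    unfolding herm_sum_def
    by (rule uniform_limit_theorem[rotated]) (auto intro!: always_eventually continuous_intros)
qed

text \<open>At the far end the lower bound of \<open>herm_sum_bounds\<close> is nonnegative because \<open>x * herm n x\<close> decreases: the values at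
\<open>5 * x\<close> and \<open>7 * x\<close> are at most \<open>1/5\<close> and \<open>1/7\<close> of the value at \<open>x\<close>.\<close>

lemma herm_sum_zero_exists:
  assumes "n \<ge> 4" "even n"
  shows "\<exists>lam>sqrt 3. herm_sum n lam (1 / 6) = 0"
proof -
  obtain x0 where x0: "x0 > sqrt 3 / 6" "herm n x0 \<le> 0" "4 * real n \<le> 3 * pi * (5 * x0)\<^sup>2"
    using herm_nonpos_point[OF assms] by blast
  have x0_pos: "x0 > 0" using x0(1) by (rule le_less_trans[rotated]) simp
  define x1 where "x1 = x0 + real n"
  have x1_pos: "x1 > 0" using x0_pos by (simp add: x1_def)
  have far: "4 * real n \<le> 3 * pi * x1\<^sup>2"
  proof -
    have "real n * real n \<le> x1\<^sup>2"
      unfolding x1_def power2_eq_square using x0_pos by (intro mult_mono) auto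
    moreover have "4 * real n \<le> real n * real n" using assms(1) by (intro mult_right_mono) auto
    ultimately have "4 * real n \<le> x1\<^sup>2" by linarith
    also have "1 * x1\<^sup>2 \<le> 3 * pi * x1\<^sup>2" using pi_gt3 by (intro mult_right_mono) auto
    finally show ?thesis by simp
  qed
  have far5: "4 * real n \<le> 3 * pi * (5 * x1)\<^sup>2"
    using beyond_threshold[OF x1_pos _ far, of "5 * x1"] x1_pos by simp
  have "5 * x1 * herm n (5 * x1) \<le> x1 * herm n x1" "7 * x1 * herm n (7 * x1) \<le> x1 * herm n x1"
    by (rule herm_times_x_antimono; use x1_pos assms(1) far in simp)+
  then have "x1 * (5 * herm n (5 * x1)) \<le> x1 * herm n x1" "x1 * (7 * herm n (7 * x1)) \<le> x1 * herm n x1"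
    by (simp_all add: mult_ac)
  then have "5 * herm n (5 * x1) \<le> herm n x1" "7 * herm n (7 * x1) \<le> herm n x1"
    using x1_pos by (simp_all add: mult_le_cancel_left_pos)
  moreover have "herm n x1 > 0" by (rule herm_pos[OF x1_pos far])
  ultimately have "0 \<le> herm n x1 - (herm n (5 * x1) + herm n (7 * x1))" by linarith
  also have "\<dots> \<le> herm_sum n (6 * x1) (1 / 6)"
    by (rule herm_sum_bounds(2)[OF assms(2) x1_pos far5])
  finally have "0 \<le> herm_sum n (6 * x1) (1 / 6)" .
  moreover have "herm_sum n (6 * x0) (1 / 6) \<le> 0"
    using herm_sum_bounds(1)[OF assms(2) x0_pos x0(3)] x0(2) by linarith
  moreover have "6 * x0 \<le> 6 * x1" by (simp add: x1_def)
  moreover have "continuous_on {6 * x0..6 * x1} (\<lambda>lam. herm_sum n lam (1 / 6))"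
    using x0_pos by (intro continuous_on_herm_sum) simp
  ultimately obtain lam where "6 * x0 \<le> lam" "herm_sum n lam (1 / 6) = 0"
    using IVT'[of "\<lambda>lam. herm_sum n lam (1 / 6)" "6 * x0" 0 "6 * x1"] by blast
  then show ?thesis using x0(1) by (intro exI[of _ lam]) linarith
qed


section \<open>Combs and the failure of the lower frame bound\<close>

definition tent :: "real \<Rightarrow> real \<Rightarrow> real" where
  "tent \<epsilon> t = max 0 (1 - \<epsilon> * \<bar>t\<bar>)"

lemma tent_bounds: "0 \<le> tent \<epsilon> t" "\<epsilon> \<ge> 0 \<Longrightarrow> tent \<epsilon> t \<le> 1"
  by (auto simp: tent_def)

text \<open>The left factor on \<open>t\<close> records that the difference is small not only in \<open>s - t\<close> but also when \<open>t\<close> is far outside the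
tent: then a nonzero difference needs \<open>s\<close> inside it, and \<open>s - t\<close> must be large. This is what makes the error terms
of the truncated comb square summable uniformly in \<open>\<epsilon>\<close>.\<close>

lemma tent_lipschitz:
  assumes "0 < \<epsilon>" "\<epsilon> \<le> 1"
  shows "\<bar>tent \<epsilon> s - tent \<epsilon> t\<bar> * (1 + \<epsilon>\<^sup>2 * t\<^sup>2) \<le> 4 * \<epsilon> * \<bar>s - t\<bar> * (1 + (s - t)\<^sup>2)"
proof -
  have "\<bar>tent \<epsilon> s - tent \<epsilon> t\<bar> \<le> \<bar>\<epsilon> * \<bar>s\<bar> - \<epsilon> * \<bar>t\<bar>\<bar>" unfolding tent_def by linarith
  also have "\<dots> = \<epsilon> * \<bar>\<bar>s\<bar> - \<bar>t\<bar>\<bar>" using assms by (simp add: abs_mult flip: right_diff_distrib)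
  also have "\<dots> \<le> \<epsilon> * \<bar>s - t\<bar>" using assms by (intro mult_left_mono) auto
  finally have lip: "\<bar>tent \<epsilon> s - tent \<epsilon> t\<bar> \<le> \<epsilon> * \<bar>s - t\<bar>" .
  have small: "\<epsilon>\<^sup>2 * r\<^sup>2 \<le> 1" if "\<epsilon> * \<bar>r\<bar> \<le> 1" for r
  proof -
    have "(\<epsilon> * \<bar>r\<bar>)\<^sup>2 \<le> 1\<^sup>2" using that assms by (intro power_mono) auto
    then show ?thesis by (simp add: power_mult_distrib)
  qed
  consider "\<epsilon> * \<bar>t\<bar> > 1" "\<epsilon> * \<bar>s\<bar> > 1" | "\<epsilon> * \<bar>t\<bar> \<le> 1" | "\<epsilon> * \<bar>s\<bar> \<le> 1" by linarith
  then show ?thesis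
  proof cases
    case 1
    then have "tent \<epsilon> s = 0" "tent \<epsilon> t = 0" by (auto simp: tent_def)
    then show ?thesis using assms by simp
  next
    case 2
    then have "\<epsilon>\<^sup>2 * t\<^sup>2 \<le> 1" by (rule small)
    then have "1 + \<epsilon>\<^sup>2 * t\<^sup>2 \<le> 4 + 4 * (s - t)\<^sup>2" using zero_le_power2[of "s - t"] by linarith
    then have "1 + \<epsilon>\<^sup>2 * t\<^sup>2 \<le> 4 * (1 + (s - t)\<^sup>2)" by (simp only: distrib_left mult_1_right)
    with lip have "\<bar>tent \<epsilon> s - tent \<epsilon> t\<bar> * (1 + \<epsilon>\<^sup>2 * t\<^sup>2) \<le> (\<epsilon> * \<bar>s - t\<bar>) * (4 * (1 + (s - t)\<^sup>2))"
      using assms by (intro mult_mono) auto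
    then show ?thesis by (simp only: mult_ac)
  next
    case 3
    have "t\<^sup>2 \<le> 2 * s\<^sup>2 + 2 * (s - t)\<^sup>2"
      using zero_le_power2[of "2 * s - t"] by (simp add: power2_eq_square algebra_simps)
    then have "\<epsilon>\<^sup>2 * t\<^sup>2 \<le> \<epsilon>\<^sup>2 * (2 * s\<^sup>2 + 2 * (s - t)\<^sup>2)" by (intro mult_left_mono) auto
    also have "\<dots> = 2 * (\<epsilon>\<^sup>2 * s\<^sup>2) + 2 * (\<epsilon>\<^sup>2 * (s - t)\<^sup>2)" by (simp only: distrib_left mult.left_commute)
    also have "\<dots> \<le> 2 * 1 + 2 * (1 * (s - t)\<^sup>2)"
      using small[OF 3] assms by (intro add_mono mult_left_mono mult_right_mono) (auto simp: power_le_one)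
    finally have "1 + \<epsilon>\<^sup>2 * t\<^sup>2 \<le> 4 + 4 * (s - t)\<^sup>2" using zero_le_power2[of "s - t"] by linarith
    then have "1 + \<epsilon>\<^sup>2 * t\<^sup>2 \<le> 4 * (1 + (s - t)\<^sup>2)" by (simp only: distrib_left mult_1_right)
    with lip have "\<bar>tent \<epsilon> s - tent \<epsilon> t\<bar> * (1 + \<epsilon>\<^sup>2 * t\<^sup>2) \<le> (\<epsilon> * \<bar>s - t\<bar>) * (4 * (1 + (s - t)\<^sup>2))"
      using assms by (intro mult_mono) auto
    then show ?thesis by (simp only: mult_ac)
  qed
qed

text \<open>The coefficients \<open>a i\<close> are spread over intervals of length \<open>\<delta>\<close> instead of point masses, so that the result is square
integrable; the teeth are disjoint as long as \<open>\<delta> \<le> L\<close>.\<close>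

definition comb :: "(int \<Rightarrow> complex) \<Rightarrow> int set \<Rightarrow> real \<Rightarrow> real \<Rightarrow> real \<Rightarrow> real \<Rightarrow> complex" where
  "comb a I L x0 \<delta> x = (\<Sum>i\<in>I. a i * indicat_real {x0..<x0 + \<delta>} (x - L * of_int i))"

lemma comb_norm_sq:
  assumes "finite I" "0 < \<delta>" "\<delta> \<le> L"
  shows "(norm (comb a I L x0 \<delta> x))\<^sup>2 = (\<Sum>i\<in>I. (norm (a i))\<^sup>2 * indicat_real {x0..<x0 + \<delta>} (x - L * of_int i))"
proof -
  have inj: "i = j" if "x - L * of_int i \<in> {x0..<x0 + \<delta>}" "x - L * of_int j \<in> {x0..<x0 + \<delta>}" for i j
  proof (rule ccontr)
    assume "i \<noteq> j"
    then have "1 \<le> \<bar>real_of_int (i - j)\<bar>" by linarith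
    then have "L * 1 \<le> L * \<bar>real_of_int (i - j)\<bar>" using assms by (intro mult_left_mono) auto
    also have "\<dots> = \<bar>L * real_of_int (i - j)\<bar>" using assms by (simp add: abs_mult)
    also have "L * real_of_int (i - j) = (x - L * of_int j) - (x - L * of_int i)" by (simp add: algebra_simps)
    also have "\<bar>\<dots>\<bar> < \<delta>" using that by auto
    finally show False using assms by simp
  qed
  show ?thesis
  proof (cases "\<exists>i\<in>I. x - L * of_int i \<in> {x0..<x0 + \<delta>}")
    case True
    then obtain j where j: "j \<in> I" "x - L * of_int j \<in> {x0..<x0 + \<delta>}" by blast
    have ind: "indicat_real {x0..<x0 + \<delta>} (x - L * of_int i) = (if i = j then 1 else 0)" for i
      using inj j(2) by (auto simp: indicator_def)
    have "comb a I L x0 \<delta> x = (\<Sum>i\<in>I. if i = j then a i else 0)"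
      unfolding comb_def ind by (intro sum.cong) auto
    also have "\<dots> = a j" using assms(1) j(1) by (simp add: sum.delta)
    finally have "comb a I L x0 \<delta> x = a j" .
    moreover have "(\<Sum>i\<in>I. (norm (a i))\<^sup>2 * indicat_real {x0..<x0 + \<delta>} (x - L * of_int i)) = (\<Sum>i\<in>I. if i = j then (norm (a i))\<^sup>2 else 0)"
      unfolding ind by (intro sum.cong) auto
    ultimately show ?thesis using assms(1) j(1) by (simp add: sum.delta)
  next
    case False
    then have "indicat_real {x0..<x0 + \<delta>} (x - L * of_int i) = 0" if "i \<in> I" for i using that by (simp add: indicator_def)
    then show ?thesis by (simp add: comb_def)
  qed
qed

lemma has_bochner_integral_tooth:
  assumes "0 < \<delta>"
  shows "has_bochner_integral lborel (\<lambda>x. indicat_real {x0..<x0 + \<delta>} (x - t)) \<delta>"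
proof -
  have "(\<lambda>x. indicat_real {x0..<x0 + \<delta>} (x - t)) = indicat_real {x0 + t..<x0 + t + \<delta>}"
    by (auto simp: indicator_def fun_eq_iff)
  moreover have "has_bochner_integral lborel (indicat_real {x0 + t..<x0 + t + \<delta>}) (measure lborel {x0 + t..<x0 + t + \<delta>})"
    using assms by (intro has_bochner_integral_real_indicator) auto
  ultimately show ?thesis using assms by simp
qed

lemma comb_measurable [measurable]: "comb a I L x0 \<delta> \<in> borel_measurable borel"
  unfolding comb_def by measurable

lemma comb_L2:
  assumes "finite I" "0 < \<delta>" "\<delta> \<le> L"
  shows "comb a I L x0 \<delta> \<in> L2_functions"
    and "(L2_norm (comb a I L x0 \<delta>))\<^sup>2 = \<delta> * (\<Sum>i\<in>I. (norm (a i))\<^sup>2)"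
proof -
  have "has_bochner_integral lborel (\<lambda>x. (norm (comb a I L x0 \<delta> x))\<^sup>2) (\<Sum>i\<in>I. (norm (a i))\<^sup>2 * \<delta>)"
    unfolding comb_norm_sq[OF assms]
    by (intro has_bochner_integral_sum has_bochner_integral_mult_right has_bochner_integral_tooth assms)
  then have *: "integrable lborel (\<lambda>x. (norm (comb a I L x0 \<delta> x))\<^sup>2)"
    "(LINT x|lborel. (norm (comb a I L x0 \<delta> x))\<^sup>2) = (\<Sum>i\<in>I. (norm (a i))\<^sup>2 * \<delta>)"
    by (auto simp: has_bochner_integral_iff)
  show "comb a I L x0 \<delta> \<in> L2_functions" using * by (simp add: L2_functions_def)
  have "0 \<le> (\<Sum>i\<in>I. (norm (a i))\<^sup>2 * \<delta>)" using assms by (intro sum_nonneg) auto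
  then show "(L2_norm (comb a I L x0 \<delta>))\<^sup>2 = \<delta> * (\<Sum>i\<in>I. (norm (a i))\<^sup>2)"
    unfolding L2_norm_def *(2) by (simp add: sum_distrib_left mult.commute)
qed

text \<open>The pairing of the point masses \<open>a i\<close>, placed at \<open>y + L * i\<close>, with the \<open>k\<close>-th translate of \<open>g\<close>.\<close>

definition fiber :: "(real \<Rightarrow> complex) \<Rightarrow> (int \<Rightarrow> complex) \<Rightarrow> int set \<Rightarrow> real \<Rightarrow> real \<Rightarrow> int \<Rightarrow> real \<Rightarrow> complex" where
  "fiber g a I L \<alpha> k y = (\<Sum>i\<in>I. a i * cnj (g (y + L * of_int i - \<alpha> * of_int k)))"

text \<open>Modulation by \<open>m * b / L\<close> has period \<open>L / b\<close>, which divides the spacing \<open>L\<close> of the teeth. All teeth therefore see the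
same phase and can be folded onto one of them, where the inner products for fixed \<open>k\<close> become Fourier coefficients.\<close>

lemma comb_inner_gabor:
  fixes b :: nat
  assumes g: "g \<in> borel_measurable borel" and gB: "\<And>x. norm (g x) \<le> B"
    and "finite I" "0 < \<delta>" "L > 0"
  shows "L2_inner (comb a I L x0 \<delta>) (gabor_system g \<alpha> (real b / L) (k, m)) =
    (LINT y|lborel. (indicat_real {x0..<x0 + \<delta>} y *\<^sub>R fiber g a I L \<alpha> k y)
       * cis (- (2 * pi * of_int m * y / (L / real b))))"
proof -
  define J where "J = {x0..<x0 + \<delta>}"
  define e where "e y = cis (- (2 * pi * of_int m * y / (L / real b)))" for y
  define p where "p i x = indicat_real J (x - L * of_int i) *\<^sub>R (e x * cnj (g (x - \<alpha> * of_int k)))" for i :: int and x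
  have [measurable]: "J \<in> sets borel" by (simp add: J_def)
  have [measurable]: "e \<in> borel_measurable borel" unfolding e_def by measurable
  note g[measurable]
  have e_norm: "norm (e y) = 1" for y by (simp add: e_def)
  have e_per: "e (L * of_int i + y) = e y" for i y
  proof -
    have "e (L * of_int i + y) = e y * cis (2 * pi * of_int (- m * int b) * of_int i)"
    proof -
      have "- (2 * pi * of_int m * (L * of_int i + y) / (L / real b))
        = - (2 * pi * of_int m * y / (L / real b)) + 2 * pi * of_int (- m * int b) * of_int i"
        using \<open>L > 0\<close> by (cases "b = 0") (simp_all add: field_simps)
      then show ?thesis by (simp only: e_def cis_mult)
    qed
    then show ?thesis by (simp only: cis_int_period mult_1_right)
  qed
  have "0 \<le> B" using order_trans[OF norm_ge_zero gB] .
  have p_int: "integrable lborel (p i)" for i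
  proof (rule Bochner_Integration.integrable_bound[where f = "\<lambda>x. B * indicat_real J (x - L * of_int i)"])
    show "integrable lborel (\<lambda>x. B * indicat_real J (x - L * of_int i))"
      using has_bochner_integral_tooth[OF \<open>0 < \<delta>\<close>] by (intro integrable_mult_right) (auto simp: J_def has_bochner_integral_iff)
    show "AE x in lborel. norm (p i x) \<le> norm (B * indicat_real J (x - L * of_int i))"
      using gB \<open>0 \<le> B\<close> by (intro AE_I2) (auto simp: p_def norm_mult e_norm split: split_indicator)
  qed (unfold p_def, measurable)
  define q where "q i y = indicat_real J y *\<^sub>R (e y * cnj (g (y + L * of_int i - \<alpha> * of_int k)))" for i :: int and y
  have shift: "p i (L * of_int i + 1 * y) = q i y" for i y
    using e_per[of i y] by (simp add: p_def q_def add.commute)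
  have pq: "(LINT x|lborel. p i x) = (LINT y|lborel. q i y)" for i
    by (subst lborel_integral_real_affine[where c = 1 and t = "L * of_int i"]) (simp_all only: shift, simp_all)
  have q_int: "integrable lborel (q i)" for i
    using lborel_integrable_real_affine[OF p_int[of i], of 1 "L * of_int i"] unfolding shift by simp
  have char: "exp (2 * complex_of_real pi * \<i> * complex_of_real (real b / L) * of_int m * complex_of_real x) = cnj (e x)" for x
  proof -
    have "cnj (e x) = cis (2 * pi * of_int m * x / (L / real b))" by (simp add: e_def cis_cnj)
    then show ?thesis by (simp add: cis_conv_exp mult_ac)
  qed
  have "comb a I L x0 \<delta> x * cnj (gabor_system g \<alpha> (real b / L) (k, m) x) = (\<Sum>i\<in>I. a i * p i x)" for x
    unfolding gabor_system_def comb_def p_def J_def prod.case char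
    by (simp add: sum_distrib_left sum_distrib_right scaleR_conv_of_real mult_ac)
  then have "L2_inner (comb a I L x0 \<delta>) (gabor_system g \<alpha> (real b / L) (k, m)) = (LINT x|lborel. (\<Sum>i\<in>I. a i * p i x))"
    by (simp only: L2_inner_def)
  also have "\<dots> = (\<Sum>i\<in>I. a i * (LINT x|lborel. p i x))"
    by (subst Bochner_Integration.integral_sum) (auto intro: integrable_mult_right p_int)
  also have "\<dots> = (LINT y|lborel. (\<Sum>i\<in>I. a i * q i y))"
    unfolding pq by (subst Bochner_Integration.integral_sum) (auto intro: integrable_mult_right q_int)
  also have "(\<lambda>y. \<Sum>i\<in>I. a i * q i y) = (\<lambda>y. (indicat_real J y *\<^sub>R fiber g a I L \<alpha> k y) * e y)"
    by (simp add: fun_eq_iff q_def fiber_def sum_distrib_right sum_distrib_left scaleR_conv_of_real mult_ac)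
  finally show ?thesis by (simp only: J_def e_def)
qed

lemma comb_modulations_bound:
  fixes b :: nat and M :: "int set"
  assumes g: "g \<in> borel_measurable borel" and gB: "\<And>x. norm (g x) \<le> B"
    and "finite I" "0 < \<delta>" "b > 0" "\<delta> \<le> L / real b" "L > 0" "finite M"
    and S: "\<And>y. x0 \<le> y \<Longrightarrow> y \<le> x0 + \<delta> \<Longrightarrow> norm (fiber g a I L \<alpha> k y) \<le> S"
  shows "(\<Sum>m\<in>M. (norm (L2_inner (comb a I L x0 \<delta>) (gabor_system g \<alpha> (real b / L) (k, m))))\<^sup>2)
    \<le> L / real b * (\<delta> * S\<^sup>2)"
proof -
  define T where "T = L / real b"
  have T: "T > 0" "\<delta> \<le> T" using assms by (auto simp: T_def)
  define J where "J = {x0..<x0 + \<delta>}"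
  have [measurable]: "J \<in> sets borel" by (simp add: J_def)
  note g[measurable]
  define u where "u y = indicat_real J y *\<^sub>R fiber g a I L \<alpha> k y" for y
  have [measurable]: "u \<in> borel_measurable borel" unfolding u_def fiber_def by measurable
  have "0 \<le> S" using order_trans[OF norm_ge_zero S[of x0]] \<open>0 < \<delta>\<close> by simp
  have uS: "norm (u y) \<le> S * indicat_real J y" for y
    using S[of y] by (auto simp: u_def J_def split: split_indicator)
  have "(\<Sum>m\<in>M. (norm (L2_inner (comb a I L x0 \<delta>) (gabor_system g \<alpha> (real b / L) (k, m))))\<^sup>2)
    = (\<Sum>m\<in>M. (norm (LINT y|lborel. u y * cis (- (2 * pi * of_int m * y / T))))\<^sup>2)"
    using comb_inner_gabor[OF g gB \<open>finite I\<close> \<open>0 < \<delta>\<close> \<open>L > 0\<close>] by (simp only: u_def J_def T_def)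
  also have "\<dots> \<le> T * (LINT y|lborel. (norm (u y))\<^sup>2)"
  proof (rule bessel_inequality[where a = x0 and B = S])
    show "norm (u y) \<le> S" for y
      using uS[of y] \<open>0 \<le> S\<close> by (auto split: split_indicator_asm)
    show "u y = 0" if "y \<notin> {x0..x0 + T}" for y using that T by (auto simp: u_def J_def)
  qed (use T \<open>finite M\<close> in auto)
  finally have 1: "(\<Sum>m\<in>M. (norm (L2_inner (comb a I L x0 \<delta>) (gabor_system g \<alpha> (real b / L) (k, m))))\<^sup>2)
    \<le> T * (LINT y|lborel. (norm (u y))\<^sup>2)" .
  have "(LINT y|lborel. (norm (u y))\<^sup>2) \<le> (LINT y|lborel. S\<^sup>2 * indicat_real J y)"
  proof (rule integral_mono_AE')
    show "integrable lborel (\<lambda>y. S\<^sup>2 * indicat_real J y)"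
      using \<open>0 < \<delta>\<close> by (intro integrable_mult_right integrable_real_indicator) (auto simp: J_def)
    show "AE y in lborel. (norm (u y))\<^sup>2 \<le> S\<^sup>2 * indicat_real J y"
    proof (intro AE_I2)
      fix y show "(norm (u y))\<^sup>2 \<le> S\<^sup>2 * indicat_real J y"
        using power_mono[OF uS[of y], of 2] by (auto simp: power_mult_distrib split: split_indicator_asm split_indicator)
    qed
  qed auto
  also have "(LINT y|lborel. S\<^sup>2 * indicat_real J y) = \<delta> * S\<^sup>2"
    using \<open>0 < \<delta>\<close> by (simp add: J_def)
  finally have "T * (LINT y|lborel. (norm (u y))\<^sup>2) \<le> T * (\<delta> * S\<^sup>2)"
    using T by (intro mult_left_mono) auto
  with 1 show ?thesis unfolding T_def by (rule order_trans)
qed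


text \<open>Under the hypothesis the infinite comb of point masses \<open>c i\<close> at \<open>z + L * i\<close> is orthogonal to all translates of \<open>g\<close>, so it
would be a bounded but not square integrable vector annihilated by the Gabor system. Multiply the masses by
\<open>tent \<epsilon>\<close> and let the teeth have length \<open>\<delta>\<close>. In the \<open>k\<close>-th fiber the orthogonality allows subtracting the
constant \<open>tent \<epsilon> (t k)\<close> from the cut-off, where \<open>t k\<close> is the centre of the translate; by \<open>tent_lipschitz\<close> and
\<open>\<epsilon>\<^sup>2 / (1 + \<epsilon>\<^sup>2 * t\<^sup>2) \<le> 1 / (1 + t\<^sup>2)\<close> the squares of the fibers at \<open>z\<close> have a sum that is bounded
independently of \<open>\<epsilon>\<close>. The error from the length of the teeth disappears when \<open>\<delta>\<close> is chosen after \<open>\<epsilon>\<close>. A lower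
frame bound would thus bound the sum of the squared masses, which however grows like \<open>1 / \<epsilon>\<close>.\<close>

theorem not_in_frame_set:
  fixes g g' :: "real \<Rightarrow> complex" and c :: "int \<Rightarrow> complex" and b :: nat
  assumes der: "\<And>x. (g has_vector_derivative g' x) (at x)"
    and decay: "\<And>x. norm (g x) \<le> C / (1 + x\<^sup>2) ^ 3" "\<And>x. norm (g' x) \<le> C / (1 + x\<^sup>2)"
    and pos: "\<alpha> > 0" "L > 0" "b > 0"
    and c: "\<And>i. norm (c i) = 1"
    and annihilated: "\<And>k::int. (\<Sum>\<^sub>\<infinity>i. c i * cnj (g (z + L * of_int i - \<alpha> * of_int k))) = 0"
  shows "(\<alpha>, real b / L) \<notin> frame_set g"
proof
  assume "(\<alpha>, real b / L) \<in> frame_set g"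
  then obtain A where A: "A > 0" and frame: "\<And>f. f \<in> L2_functions \<Longrightarrow>
      (\<lambda>i. (norm (L2_inner f (gabor_system g \<alpha> (real b / L) i)))\<^sup>2) summable_on UNIV \<and>
      A * (L2_norm f)\<^sup>2 \<le> (\<Sum>\<^sub>\<infinity>i. (norm (L2_inner f (gabor_system g \<alpha> (real b / L) i)))\<^sup>2)"
    unfolding frame_set_def is_frame_def by auto
  have C0: "0 \<le> C" using order_trans[OF norm_ge_zero decay(2)[of 0]] by simp
  have decay1: "norm (g x) \<le> C / (1 + x\<^sup>2)" for x
  proof -
    have "(1 + x\<^sup>2) ^ 1 \<le> (1 + x\<^sup>2) ^ 3" by (intro power_increasing) auto
    then have "C / (1 + x\<^sup>2) ^ 3 \<le> C / (1 + x\<^sup>2)"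
      using C0 by (intro divide_left_mono) (auto intro!: mult_pos_pos add_pos_nonneg zero_less_power)
    then show ?thesis using decay(1)[of x] by linarith
  qed
  have gB: "norm (g x) \<le> C" for x
  proof -
    have "C / (1 + x\<^sup>2) \<le> C / 1" using C0 by (intro divide_left_mono) (auto intro!: add_pos_nonneg)
    then show ?thesis using decay1[of x] by simp
  qed
  have g_meas: "g \<in> borel_measurable borel"
    using der by (intro borel_measurable_continuous_onI continuous_at_imp_continuous_on)
      (auto intro: has_vector_derivative_continuous)
  obtain M1 :: real where M1: "M1 > 0" "\<And>(a::real) (K :: int set). finite K \<Longrightarrow> (\<Sum>k\<in>K. 1 / (1 + (L * of_int k - a)\<^sup>2)) \<le> M1"
    using lattice_sums_bounded[OF pos(2)] by blast
  obtain M2 :: real where M2: "M2 > 0" "\<And>(a::real) (K :: int set). finite K \<Longrightarrow> (\<Sum>k\<in>K. 1 / (1 + (\<alpha> * of_int k - a)\<^sup>2)) \<le> M2"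
    using lattice_sums_bounded[OF pos(1)] by blast
  define T where "T = L / real b"
  have T: "T > 0" "T \<le> L" using pos by (auto simp: T_def field_simps)
  define E where "E = (4 * C * M1)\<^sup>2 * M2"
  have E0: "0 \<le> E" using M2(1) by (simp add: E_def)
  have key: "A * (\<Sum>i\<in>I. (tent \<epsilon> (L * of_int i))\<^sup>2) \<le> T * (2 * E + 2)"
    if eps: "0 < \<epsilon>" "\<epsilon> \<le> 1" and I: "finite I" "\<And>i. i \<notin> I \<Longrightarrow> tent \<epsilon> (L * of_int i) = 0" for \<epsilon> I
  proof -
    define a where "a i = c i * of_real (tent \<epsilon> (L * of_int i))" for i
    have a_norm: "norm (a i) = tent \<epsilon> (L * of_int i)" for i
      using c[of i] tent_bounds(1)[of \<epsilon>] by (simp add: a_def norm_mult)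
    define t where "t k = \<alpha> * of_int k - z" for k :: int
    have P: "norm (fiber g a I L \<alpha> k z) \<le> 4 * C * M1 * \<epsilon> / (1 + \<epsilon>\<^sup>2 * (t k)\<^sup>2)" for k
    proof -
      define G where "G i = cnj (g (z + L * of_int i - \<alpha> * of_int k))" for i :: int
      have G_arg: "z + L * of_int i - \<alpha> * of_int k = L * of_int i - t k" for i by (simp add: t_def)
      \<comment> \<open>the uncut series over all \<open>i\<close>, which sums to zero by orthogonality\<close>
      have cG: "(\<lambda>i. c i * G i) summable_on UNIV"
        by (rule lattice_abs_summable(2)[OF pos(2), where C = C and a = "t k"])
          (use decay1 in \<open>simp add: norm_mult c G_def G_arg\<close>)
      have aG: "((\<lambda>i. a i * G i) has_sum fiber g a I L \<alpha> k z) UNIV"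
      proof -
        have "((\<lambda>i. a i * G i) has_sum (\<Sum>i\<in>I. a i * G i)) I" using I(1) by (rule has_sum_finite)
        then have "((\<lambda>i. a i * G i) has_sum (\<Sum>i\<in>I. a i * G i)) UNIV"
          by (rule has_sum_cong_neutral[THEN iffD1, rotated -1]) (use I(2) in \<open>auto simp: a_def\<close>)
        then show ?thesis by (simp add: fiber_def G_def)
      qed
      have "((\<lambda>i. c i * G i) has_sum 0) UNIV"
        using has_sum_infsum[OF cG] annihilated[of k] by (simp add: G_def)
      from has_sum_add[OF aG has_sum_cmult_right[OF this, of "- complex_of_real (tent \<epsilon> (t k))"]]
      have S1: "((\<lambda>i. (of_real (tent \<epsilon> (L * of_int i)) - of_real (tent \<epsilon> (t k))) * (c i * G i)) has_sum fiber g a I L \<alpha> k z) UNIV"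
        by (simp add: a_def algebra_simps)
      have S2: "((\<lambda>i::int. (4 * C * \<epsilon> / (1 + \<epsilon>\<^sup>2 * (t k)\<^sup>2)) * (1 / (1 + (L * of_int i - t k)\<^sup>2))) has_sum
         ((4 * C * \<epsilon> / (1 + \<epsilon>\<^sup>2 * (t k)\<^sup>2)) * (\<Sum>\<^sub>\<infinity>i::int. 1 / (1 + (L * of_int i - t k)\<^sup>2)))) UNIV"
        by (intro has_sum_cmult_right has_sum_infsum lattice_summable pos)
      have "norm (fiber g a I L \<alpha> k z) \<le> (4 * C * \<epsilon> / (1 + \<epsilon>\<^sup>2 * (t k)\<^sup>2)) * (\<Sum>\<^sub>\<infinity>i::int. 1 / (1 + (L * of_int i - t k)\<^sup>2))"
      proof (rule norm_infsum_le[OF S1 S2])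
        fix i :: int
        define d where "d = L * of_int i - t k"
        define w where "w = 1 + \<epsilon>\<^sup>2 * (t k)\<^sup>2"
        have w: "w > 0" by (simp add: w_def add_pos_nonneg)
        define v where "v = 1 + d\<^sup>2"
        have v: "v > 0" by (simp add: v_def add_pos_nonneg)
        have dv: "\<bar>d\<bar> \<le> v"
          unfolding v_def using zero_le_power2[of "\<bar>d\<bar> - 1"] by (simp add: power2_diff)
        have "\<bar>tent \<epsilon> (L * of_int i) - tent \<epsilon> (t k)\<bar> * w \<le> 4 * \<epsilon> * \<bar>d\<bar> * v"
          using tent_lipschitz[OF eps, of "L * of_int i" "t k"] by (simp add: w_def v_def d_def)
        also have "\<dots> \<le> 4 * \<epsilon> * v * v" using dv v eps by (intro mult_right_mono mult_left_mono) auto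
        finally have 1: "\<bar>tent \<epsilon> (L * of_int i) - tent \<epsilon> (t k)\<bar> \<le> 4 * \<epsilon> * v * v / w"
          using w by (simp add: pos_le_divide_eq)
        have 2: "norm (c i * G i) \<le> C / v ^ 3"
          using decay(1)[of "L * of_int i - t k"] by (simp add: norm_mult c G_def G_arg v_def d_def)
        have "norm ((of_real (tent \<epsilon> (L * of_int i)) - of_real (tent \<epsilon> (t k))) * (c i * G i))
           = \<bar>tent \<epsilon> (L * of_int i) - tent \<epsilon> (t k)\<bar> * norm (c i * G i)"
          by (simp only: norm_mult norm_of_real flip: of_real_diff)
        also have "\<dots> \<le> (4 * \<epsilon> * v * v / w) * (C / v ^ 3)"
          using 1 2 eps v w by (intro mult_mono) auto
        also have "\<dots> = (4 * C * \<epsilon> / w) * (1 / v)"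
          using v w by (simp add: power3_eq_cube)
        finally show "norm ((of_real (tent \<epsilon> (L * of_int i)) - of_real (tent \<epsilon> (t k))) * (c i * G i))
           \<le> (4 * C * \<epsilon> / (1 + \<epsilon>\<^sup>2 * (t k)\<^sup>2)) * (1 / (1 + (L * of_int i - t k)\<^sup>2))"
          by (simp only: w_def v_def d_def)
      qed
      also have "\<dots> \<le> (4 * C * \<epsilon> / (1 + \<epsilon>\<^sup>2 * (t k)\<^sup>2)) * M1"
      proof (rule mult_left_mono)
        show "(\<Sum>\<^sub>\<infinity>i::int. 1 / (1 + (L * of_int i - t k)\<^sup>2)) \<le> M1"
          by (intro infsum_le_finite_sums lattice_summable pos M1(2))
      qed (use C0 eps in \<open>auto intro!: divide_nonneg_nonneg add_nonneg_nonneg\<close>)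
      finally show ?thesis by (simp add: mult_ac)
    qed
    have P_sq: "(norm (fiber g a I L \<alpha> k z))\<^sup>2 \<le> (4 * C * M1)\<^sup>2 * (1 / (1 + (t k)\<^sup>2))" for k
    proof -
      define w where "w = 1 + \<epsilon>\<^sup>2 * (t k)\<^sup>2"
      have w: "w \<ge> 1" by (simp add: w_def)
      have "\<epsilon>\<^sup>2 \<le> 1" using eps by (simp add: power_le_one)
      then have "\<epsilon>\<^sup>2 * (1 + (t k)\<^sup>2) \<le> w" by (simp add: w_def distrib_left)
      also have "w * 1 \<le> w * w" using w by (intro mult_left_mono) auto
      finally have "\<epsilon>\<^sup>2 * (1 + (t k)\<^sup>2) \<le> w\<^sup>2" by (simp add: power2_eq_square)
      then have 1: "\<epsilon>\<^sup>2 / w\<^sup>2 \<le> 1 / (1 + (t k)\<^sup>2)"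
        using w by (simp add: divide_le_eq pos_le_divide_eq add_pos_nonneg mult.commute)
      have "(norm (fiber g a I L \<alpha> k z))\<^sup>2 \<le> (4 * C * M1 * \<epsilon> / w)\<^sup>2"
        using P[of k] by (intro power_mono) (auto simp: w_def)
      also have "\<dots> = (4 * C * M1)\<^sup>2 * (\<epsilon>\<^sup>2 / w\<^sup>2)" by (simp add: power_divide power_mult_distrib)
      also have "\<dots> \<le> (4 * C * M1)\<^sup>2 * (1 / (1 + (t k)\<^sup>2))" using 1 by (intro mult_left_mono) auto
      finally show ?thesis .
    qed
    \<comment> \<open>\<open>\<delta> * Q k\<close> bounds the variation of the \<open>k\<close>-th fiber over one tooth\<close>
    define Q where "Q k = (\<Sum>i\<in>I. 3 * C * (1 / (1 + (L * of_int i - t k)\<^sup>2)))" for k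
    have Q0: "0 \<le> Q k" for k unfolding Q_def using C0 by (intro sum_nonneg) auto
    have Q1: "Q k \<le> 3 * C * M1" for k
      unfolding Q_def sum_distrib_left[symmetric] using M1(2)[OF I(1)] C0 by (intro mult_left_mono) auto
    define D where "D = 3 * C * M1 * (real (card I) * (3 * C * M2))"
    have D0: "0 \<le> D" using C0 M1(1) M2(1) by (simp add: D_def)
    have Q_sum: "(\<Sum>k\<in>K. (Q k)\<^sup>2) \<le> D" if "finite K" for K
    proof -
      have "(\<Sum>k\<in>K. (Q k)\<^sup>2) \<le> (\<Sum>k\<in>K. (3 * C * M1) * Q k)"
        unfolding power2_eq_square using Q0 Q1 by (intro sum_mono mult_right_mono) auto
      also have "\<dots> = (3 * C * M1) * (\<Sum>k\<in>K. Q k)" by (simp only: sum_distrib_left)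
      also have "(\<Sum>k\<in>K. Q k) = (\<Sum>i\<in>I. \<Sum>k\<in>K. 3 * C * (1 / (1 + (L * of_int i - t k)\<^sup>2)))"
        unfolding Q_def by (rule sum.swap)
      also have "(3 * C * M1) * \<dots> \<le> (3 * C * M1) * (\<Sum>i\<in>I. 3 * C * M2)"
      proof (intro mult_left_mono sum_mono)
        fix i
        have eq: "(L * of_int i - t k)\<^sup>2 = (\<alpha> * of_int k - (L * of_int i + z))\<^sup>2" for k
          by (simp add: t_def power2_commute algebra_simps)
        show "(\<Sum>k\<in>K. 3 * C * (1 / (1 + (L * of_int i - t k)\<^sup>2))) \<le> 3 * C * M2"
          unfolding eq sum_distrib_left[symmetric] using M2(2)[OF that] C0 by (intro mult_left_mono) auto
      qed (use C0 M1(1) in auto)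
      finally show ?thesis by (simp add: D_def)
    qed
    define \<delta> where "\<delta> = min (min 1 T) (1 / (D + 1))"
    have \<delta>: "0 < \<delta>" "\<delta> \<le> 1" "\<delta> \<le> T" "\<delta> \<le> 1 / (D + 1)" using T D0 by (auto simp: \<delta>_def)
    have \<delta>D: "\<delta>\<^sup>2 * D \<le> 1"
    proof -
      have "\<delta>\<^sup>2 \<le> \<delta>" unfolding power2_eq_square using \<delta> by (intro mult_left_le) auto
      then have "\<delta>\<^sup>2 * D \<le> (1 / (D + 1)) * D" using \<delta> D0 by (intro mult_right_mono) auto
      also have "\<dots> \<le> 1" using D0 by (simp add: divide_simps)
      finally show ?thesis .
    qed
    define S where "S k = norm (fiber g a I L \<alpha> k z) + \<delta> * Q k" for k
    have S: "norm (fiber g a I L \<alpha> k y) \<le> S k" if y: "z \<le> y" "y \<le> z + \<delta>" for y k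
    proof -
      have "norm (fiber g a I L \<alpha> k y - fiber g a I L \<alpha> k z) \<le> (\<Sum>i\<in>I. \<delta> * (3 * C * (1 / (1 + (L * of_int i - t k)\<^sup>2))))"
        unfolding fiber_def sum_subtractf[symmetric]
      proof (rule sum_norm_le)
        fix i assume "i \<in> I"
        have ai: "norm (a i) \<le> 1" using tent_bounds(2)[of \<epsilon>] eps by (simp add: a_norm)
        have arg: "y + L * of_int i - \<alpha> * of_int k - (z + L * of_int i - \<alpha> * of_int k) = y - z"
          "z + L * of_int i - \<alpha> * of_int k = L * of_int i - t k" by (auto simp: t_def)
        have "norm (g (y + L * of_int i - \<alpha> * of_int k) - g (z + L * of_int i - \<alpha> * of_int k))
          \<le> 3 * C * \<bar>y - z\<bar> / (1 + (z + L * of_int i - \<alpha> * of_int k)\<^sup>2)"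
        proof -
          have "\<bar>y - z\<bar> \<le> 1" using y \<delta> by simp
          then show ?thesis
            using lipschitz_with_weight[OF der decay(2), of "y + L * of_int i - \<alpha> * of_int k" "z + L * of_int i - \<alpha> * of_int k"]
            unfolding arg(1) by blast
        qed
        also have "\<dots> \<le> 3 * C * \<delta> / (1 + (z + L * of_int i - \<alpha> * of_int k)\<^sup>2)"
          using y C0 by (intro divide_right_mono mult_left_mono) auto
        also have "\<dots> = \<delta> * (3 * C * (1 / (1 + (L * of_int i - t k)\<^sup>2)))"
          unfolding arg(2) by simp
        finally have 1: "norm (g (y + L * of_int i - \<alpha> * of_int k) - g (z + L * of_int i - \<alpha> * of_int k))
          \<le> \<delta> * (3 * C * (1 / (1 + (L * of_int i - t k)\<^sup>2)))" .
        have "norm (a i * cnj (g (y + L * of_int i - \<alpha> * of_int k)) - a i * cnj (g (z + L * of_int i - \<alpha> * of_int k)))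
          = norm (a i) * norm (g (y + L * of_int i - \<alpha> * of_int k) - g (z + L * of_int i - \<alpha> * of_int k))"
          by (metis complex_cnj_diff complex_mod_cnj norm_mult right_diff_distrib)
        also have "\<dots> \<le> 1 * (\<delta> * (3 * C * (1 / (1 + (L * of_int i - t k)\<^sup>2))))"
          using ai 1 by (intro mult_mono) auto
        finally show "norm (a i * cnj (g (y + L * of_int i - \<alpha> * of_int k)) - a i * cnj (g (z + L * of_int i - \<alpha> * of_int k)))
          \<le> \<delta> * (3 * C * (1 / (1 + (L * of_int i - t k)\<^sup>2)))" by simp
      qed
      also have "\<dots> = \<delta> * Q k" by (simp only: Q_def sum_distrib_left)
      finally show ?thesis using norm_triangle_sub[of "fiber g a I L \<alpha> k y" "fiber g a I L \<alpha> k z"] by (simp add: S_def)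
    qed
    have S_sum: "(\<Sum>k\<in>K. (S k)\<^sup>2) \<le> 2 * E + 2" if "finite K" for K
    proof -
      have "(S k)\<^sup>2 \<le> 2 * ((4 * C * M1)\<^sup>2 * (1 / (1 + (t k)\<^sup>2))) + 2 * (\<delta>\<^sup>2 * (Q k)\<^sup>2)" for k
      proof -
        have "(p + q)\<^sup>2 \<le> 2 * p\<^sup>2 + 2 * q\<^sup>2" for p q :: real
          using zero_le_power2[of "p - q"] by (simp add: power2_eq_square algebra_simps)
        then have "(S k)\<^sup>2 \<le> 2 * (norm (fiber g a I L \<alpha> k z))\<^sup>2 + 2 * (\<delta> * Q k)\<^sup>2" unfolding S_def .
        then show ?thesis using P_sq[of k] by (simp add: power_mult_distrib)
      qed
      then have "(\<Sum>k\<in>K. (S k)\<^sup>2) \<le> (\<Sum>k\<in>K. 2 * ((4 * C * M1)\<^sup>2 * (1 / (1 + (t k)\<^sup>2))) + 2 * (\<delta>\<^sup>2 * (Q k)\<^sup>2))"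
        by (rule sum_mono)
      also have "\<dots> = 2 * ((4 * C * M1)\<^sup>2 * (\<Sum>k\<in>K. 1 / (1 + (t k)\<^sup>2))) + 2 * (\<delta>\<^sup>2 * (\<Sum>k\<in>K. (Q k)\<^sup>2))"
        by (simp only: sum.distrib sum_distrib_left)
      also have "\<dots> \<le> 2 * ((4 * C * M1)\<^sup>2 * M2) + 2 * (\<delta>\<^sup>2 * D)"
        using M2(2)[OF that, of z] Q_sum[OF that] by (intro add_mono mult_left_mono) (auto simp: t_def)
      finally show ?thesis using \<delta>D by (simp add: E_def)
    qed
    define f where "f = comb a I L z \<delta>"
    have "\<delta> \<le> L" using \<delta>(3) T(2) by linarith
    note f = comb_L2[OF I(1) \<delta>(1) this, of a z, folded f_def]
    define N where "N = (\<lambda>j. (norm (L2_inner f (gabor_system g \<alpha> (real b / L) j)))\<^sup>2)"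
    have "A * (\<delta> * (\<Sum>i\<in>I. (tent \<epsilon> (L * of_int i))\<^sup>2)) \<le> infsum N UNIV"
      using frame[OF f(1)] f(2) by (simp add: a_norm N_def)
    also have "infsum N UNIV \<le> T * (\<delta> * (2 * E + 2))"
    proof (rule infsum_le_finite_sums)
      show "N summable_on UNIV" using frame[OF f(1)] by (simp add: N_def)
      fix X :: "(int \<times> int) set" assume X: "finite X"
      define K where "K = fst ` X"
      define M where "M = snd ` X"
      have fin: "finite K" "finite M" using X by (auto simp: K_def M_def)
      have "sum N X \<le> sum N (K \<times> M)"
        using fin by (intro sum_mono2) (force simp: K_def M_def N_def)+
      also have "\<dots> = (\<Sum>k\<in>K. \<Sum>m\<in>M. N (k, m))" by (simp add: sum.cartesian_product)
      also have "\<dots> \<le> (\<Sum>k\<in>K. T * (\<delta> * (S k)\<^sup>2))"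
        unfolding N_def f_def T_def
        by (intro sum_mono comb_modulations_bound[OF g_meas gB I(1) \<delta>(1) pos(3) _ pos(2) fin(2) S])
          (use \<delta> in \<open>auto simp: T_def\<close>)
      also have "\<dots> = T * (\<delta> * (\<Sum>k\<in>K. (S k)\<^sup>2))" by (simp only: sum_distrib_left)
      also have "\<dots> \<le> T * (\<delta> * (2 * E + 2))"
        using S_sum[OF fin(1)] T \<delta> by (intro mult_left_mono) auto
      finally show "sum N X \<le> T * (\<delta> * (2 * E + 2))" .
    qed
    finally have "\<delta> * (A * (\<Sum>i\<in>I. (tent \<epsilon> (L * of_int i))\<^sup>2)) \<le> \<delta> * (T * (2 * E + 2))"
      by (simp only: mult.left_commute)
    then show ?thesis using \<delta>(1) by (simp only: mult_le_cancel_left_pos)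
  qed
  define Z where "Z = T * (2 * E + 2) / A"
  \<comment> \<open>the tent is taken so wide that \<open>J + 1\<close> masses keep at least half of their size\<close>
  obtain J :: nat where J: "real J > 4 * Z" using reals_Archimedean2 by blast
  define \<epsilon> where "\<epsilon> = min 1 (1 / (2 * L * (real J + 1)))"
  have eps: "0 < \<epsilon>" "\<epsilon> \<le> 1" "\<epsilon> \<le> 1 / (2 * L * (real J + 1))" using pos by (auto simp: \<epsilon>_def)
  define I where "I = {i::int. \<bar>i\<bar> \<le> \<lceil>1 / (\<epsilon> * L)\<rceil>}"
  have "I = {- \<lceil>1 / (\<epsilon> * L)\<rceil>..\<lceil>1 / (\<epsilon> * L)\<rceil>}" by (auto simp: I_def)
  then have finI: "finite I" by simp
  have outside: "tent \<epsilon> (L * of_int i) = 0" if "i \<notin> I" for i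
  proof -
    have "1 / (\<epsilon> * L) \<le> \<bar>of_int i\<bar>" using that by (simp add: I_def) linarith
    then have "1 \<le> \<epsilon> * (L * \<bar>of_int i\<bar>)" using eps pos by (simp add: pos_divide_le_eq mult_ac)
    then show ?thesis using pos by (simp add: tent_def abs_mult)
  qed
  have half: "tent \<epsilon> (L * real_of_int (int i)) \<ge> 1 / 2" if "i \<le> J" for i
  proof -
    have "\<epsilon> * (L * real i) \<le> (1 / (2 * L * (real J + 1))) * (L * (real J + 1))"
      using eps pos that by (intro mult_mono) auto
    also have "\<dots> = 1 / 2" using pos by simp
    finally show ?thesis using pos by (simp add: tent_def abs_mult)
  qed
  have in_I: "int ` {..J} \<subseteq> I"
  proof
    fix i assume "i \<in> int ` {..J}"
    then have "tent \<epsilon> (L * of_int i) \<ge> 1 / 2" using half by auto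
    then show "i \<in> I" using outside[of i] by (cases "i \<in> I") auto
  qed
  have "real (J + 1) * (1 / 2)\<^sup>2 = (\<Sum>i\<in>{..J}. (1 / 2)\<^sup>2)" by simp
  also have "\<dots> \<le> (\<Sum>i\<in>{..J}. (tent \<epsilon> (L * of_int (int i)))\<^sup>2)"
    by (intro sum_mono power_mono half) auto
  also have "\<dots> = (\<Sum>i\<in>int ` {..J}. (tent \<epsilon> (L * of_int i))\<^sup>2)"
    by (subst sum.reindex) auto
  also have "\<dots> \<le> (\<Sum>i\<in>I. (tent \<epsilon> (L * of_int i))\<^sup>2)"
    using finI in_I by (intro sum_mono2) auto
  finally have "A * (real (J + 1) * (1 / 2)\<^sup>2) \<le> A * (\<Sum>i\<in>I. (tent \<epsilon> (L * of_int i))\<^sup>2)"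
    using A by (intro mult_left_mono) auto
  also have "\<dots> \<le> T * (2 * E + 2)" using key[OF eps(1,2) finI outside] .
  finally have "real (J + 1) / 4 \<le> Z"
    unfolding Z_def using A by (simp add: pos_le_divide_eq power2_eq_square mult_ac)
  then show False using J by simp
qed


section \<open>The six points\<close>

lemma herm_sum_plus_int:
  "herm_sum n L (y + of_int q) = (-1) powi q * herm_sum n L y"
proof (induction q rule: int_induct[where k = 0])
  case (step1 i)
  then show ?case using herm_sum_plus_1[of n L "y + of_int i"] by (simp add: power_int_add add.assoc)
next
  case (step2 i)
  have "y + of_int i = (y + of_int (i - 1)) + 1" by simp
  with herm_sum_plus_1[of n L "y + of_int (i - 1)"]
  have "herm_sum n L (y + of_int i) = - herm_sum n L (y + of_int (i - 1))" by (simp only:)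
  then show ?case using step2 by (simp add: power_int_diff)
qed simp

lemma herm_sum_zero_thirds:
  assumes "even n" and zero: "herm_sum n L (1 / 6) = 0"
  shows "herm_sum n L (1 / 6 + of_int r / 3) = 0"
proof -
  have half: "herm_sum n L (1 / 2) = 0"
    using herm_sum_plus_1[of n L "- (1 / 2)"] herm_sum_minus[OF assms(1), of L "1 / 2"] by simp
  have five: "herm_sum n L (5 / 6) = 0"
    using herm_sum_plus_1[of n L "- (1 / 6)"] herm_sum_minus[OF assms(1), of L "1 / 6"] zero by simp
  define q s where "q = r div 3" and "s = r mod 3"
  have "of_int r = (3 * of_int q + of_int s :: real)"
    unfolding q_def s_def by (metis mult_div_mod_eq of_int_add of_int_mult of_int_numeral)
  then have "1 / 6 + of_int r / 3 = (1 / 6 + of_int s / 3) + (of_int q :: real)" by simp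
  moreover have "s = 0 \<or> s = 1 \<or> s = 2" unfolding s_def by presburger
  then have "herm_sum n L (1 / 6 + of_int s / 3) = 0" using zero half five by auto
  ultimately show ?thesis by (simp only: herm_sum_plus_int mult_zero_right)
qed

text \<open>The translates by multiples of \<open>a * L / 3\<close> see the comb at \<open>1/6 + r/3\<close>, where the alternating sum vanishes. Larger \<open>a\<close>
and \<open>b\<close> pass to a subsystem and to a finer period of the modulations, and neither affects the orthogonality.\<close>

lemma hermite_fun_not_frame:
  fixes a b :: nat
  assumes "even n" "L > 0" and zero: "herm_sum n L (1 / 6) = 0" and "a > 0" "b > 0"
  shows "(real a * L / 3, real b / L) \<notin> frame_set (hermite_fun n)"
proof -
  define c where "c = hermite_const n powr (- 1 / 2)"
  have c: "c > 0" using hermite_const_pos[of n] by (simp add: c_def)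
  have h: "hermite_fun n = (\<lambda>x. complex_of_real (c * herm n x))"
    by (simp add: fun_eq_iff hermite_fun_eq c_def)
  obtain C1 where C1: "\<And>x. \<bar>herm n x\<bar> \<le> C1 / (1 + x\<^sup>2) ^ 3" using herm_weight by metis
  obtain C2 where C2: "\<And>x. \<bar>herm' n x\<bar> \<le> C2 / (1 + x\<^sup>2) ^ 1" using herm'_weight by metis
  define C where "C = c * max C1 C2"
  show ?thesis
  proof (rule not_in_frame_set[where g' = "\<lambda>x. complex_of_real (c * herm' n x)" and C = C
        and c = "\<lambda>i. (-1) powi i" and z = "L * (1 / 6)"])
    show "(hermite_fun n has_vector_derivative complex_of_real (c * herm' n x)) (at x)" for x
      unfolding h using DERIV_cmult[OF herm_has_derivative[of n x], of c]
      by (intro has_vector_derivative_of_real) (simp add: has_real_derivative_iff_has_vector_derivative)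
    show "norm (hermite_fun n x) \<le> C / (1 + x\<^sup>2) ^ 3" for x
    proof -
      have "norm (hermite_fun n x) = c * \<bar>herm n x\<bar>" using c by (simp add: h norm_mult)
      also have "\<dots> \<le> c * (C1 / (1 + x\<^sup>2) ^ 3)" using c C1 by (intro mult_left_mono) auto
      also have "\<dots> \<le> c * (max C1 C2 / (1 + x\<^sup>2) ^ 3)" using c by (intro mult_left_mono divide_right_mono) auto
      finally show ?thesis by (simp add: C_def)
    qed
    show "norm (complex_of_real (c * herm' n x)) \<le> C / (1 + x\<^sup>2)" for x
    proof -
      have "norm (complex_of_real (c * herm' n x)) = c * \<bar>herm' n x\<bar>" using c by (simp add: norm_mult)
      also have "\<dots> \<le> c * (C2 / (1 + x\<^sup>2) ^ 1)" using c C2 by (intro mult_left_mono) auto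
      also have "\<dots> \<le> c * (max C1 C2 / (1 + x\<^sup>2) ^ 1)" using c by (intro mult_left_mono divide_right_mono) auto
      finally show ?thesis by (simp add: C_def)
    qed
    show "(\<Sum>\<^sub>\<infinity>i. (-1) powi i * cnj (hermite_fun n (L * (1 / 6) + L * of_int i - real a * L / 3 * of_int k))) = 0" for k :: int
    proof -
      define y where "y = 1 / 6 + of_int (- (int a * k)) / (3::real)"
      have "L * (1 / 6) + L * of_int i - real a * L / 3 * of_int k = L * (of_int i + y)" for i
        by (simp add: y_def algebra_simps)
      then have "(-1) powi i * cnj (hermite_fun n (L * (1 / 6) + L * of_int i - real a * L / 3 * of_int k))
         = complex_of_real c * complex_of_real ((-1) powi i * herm n (L * (of_int i + y)))" for i
        by (simp add: h)
      then have "(\<Sum>\<^sub>\<infinity>i. (-1) powi i * cnj (hermite_fun n (L * (1 / 6) + L * of_int i - real a * L / 3 * of_int k)))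
         = complex_of_real c * complex_of_real (herm_sum n L y)"
        by (simp only: infsum_cmult_right' infsum_of_real_complex[OF herm_sum_summable[OF \<open>L > 0\<close>]] herm_sum_def)
      also have "herm_sum n L y = 0"
        unfolding y_def by (rule herm_sum_zero_thirds[OF \<open>even n\<close> zero])
      finally show ?thesis by simp
    qed
    show "norm ((-1) powi i :: complex) = 1" for i by (simp add: norm_power_int)
  qed (use assms in auto)
qed

lemma zak_hermite_fun:
  assumes "lam > 0"
  shows "zak lam (hermite_fun n) (1 / 6) (1 / 2) =
    complex_of_real (sqrt lam * hermite_const n powr (- 1 / 2) * herm_sum n lam (1 / 6))"
proof -
  define c where "c = hermite_const n powr (- 1 / 2)"
  have "hermite_fun n (lam * (1 / 6 + of_int k)) * exp (- 2 * complex_of_real pi * \<i> * of_int k * complex_of_real (1 / 2))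
    = complex_of_real c * complex_of_real ((-1) powi k * herm n (lam * (of_int k + 1 / 6)))" for k :: int
  proof -
    have "- 2 * complex_of_real pi * \<i> * of_int k * complex_of_real (1 / 2) = \<i> * complex_of_real (of_int (- k) * pi)"
      by simp
    then have "exp (- 2 * complex_of_real pi * \<i> * of_int k * complex_of_real (1 / 2)) = cis (of_int (- k) * pi)"
      by (simp only: cis_conv_exp)
    also have "\<dots> = (-1) powi (- k)" using cis_power_int[of pi "- k"] by simp
    finally have "exp (- 2 * complex_of_real pi * \<i> * of_int k * complex_of_real (1 / 2)) = (-1) powi k"
      by (simp only: power_int_minus_one_minus)
    then show ?thesis unfolding hermite_fun_eq c_def[symmetric] by (simp add: add.commute)
  qed
  then show ?thesis
    unfolding zak_def herm_sum_def c_def[symmetric]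
    by (simp only: infsum_cmult_right' infsum_of_real_complex[OF herm_sum_summable[OF assms]]) simp
qed

theorem mainTheorem3:
  fixes n :: nat
  assumes "n \<ge> 4" and "even n"
  shows "\<exists>lam2::real. lam2 > sqrt 3 \<and>
    zak lam2 (hermite_fun n) (1 / 6) (1 / 2) = 0 \<and>
    (lam2 / 3, 1 / lam2) \<notin> frame_set (hermite_fun n) \<and>
    (2 * lam2 / 3, 1 / lam2) \<notin> frame_set (hermite_fun n) \<and>
    (1 / lam2, lam2 / 3) \<notin> frame_set (hermite_fun n) \<and>
    (1 / lam2, 2 * lam2 / 3) \<notin> frame_set (hermite_fun n) \<and>
    (2 / lam2, lam2 / 3) \<notin> frame_set (hermite_fun n) \<and>
    (lam2 / 3, 2 / lam2) \<notin> frame_set (hermite_fun n)"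
proof -
  obtain lam where lam: "lam > sqrt 3" and zero: "herm_sum n lam (1 / 6) = 0"
    using herm_sum_zero_exists[OF assms] by blast
  have pos: "lam > 0" using lam by (rule le_less_trans[rotated]) simp
  have zero': "herm_sum n (3 / lam) (1 / 6) = 0"
    using herm_sum_functional_equation[OF pos \<open>even n\<close>] zero pos by simp
  note nf = hermite_fun_not_frame[OF \<open>even n\<close> pos zero]
  note nf' = hermite_fun_not_frame[OF \<open>even n\<close> _ zero']
  have "zak lam (hermite_fun n) (1 / 6) (1 / 2) = 0"
    by (simp add: zak_hermite_fun[OF pos] zero)
  moreover have "(lam / 3, 1 / lam) \<notin> frame_set (hermite_fun n)" using nf[of 1 1] by simp
  moreover have "(2 * lam / 3, 1 / lam) \<notin> frame_set (hermite_fun n)" using nf[of 2 1] by simp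
  moreover have "(lam / 3, 2 / lam) \<notin> frame_set (hermite_fun n)" using nf[of 1 2] by simp
  moreover have "(1 / lam, lam / 3) \<notin> frame_set (hermite_fun n)" using nf'[of 1 1] pos by simp
  moreover have "(2 / lam, lam / 3) \<notin> frame_set (hermite_fun n)" using nf'[of 2 1] pos by simp
  moreover have "(1 / lam, 2 * lam / 3) \<notin> frame_set (hermite_fun n)" using nf'[of 1 2] pos by simp
  ultimately show ?thesis using lam by blast
qed

end
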